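(* Let $A$ be the generator of an exponentially stable $C_0$-semigroup on a Hilbert space $H$, and suppose that $A^{-1}$ generates a bounded $C_0$-semigroup on $H$, i.e. $\sup_{t\ge0}\|e^{A^{-1}t}\|<\infty$. Let $(\tau_n)_{n\in\mathbb{N}_0}$ satisfy $0<\inf_n\tau_n\le\sup_n\tau_n<\infty$, and let $(x_n)_{n\in\mathbb{N}_0}$ be the solution of \[ x_{n+1}=A_d(\tau_n)x_n,\quad n\in\mathbb{N}_0,\qquad x_0\in H, \] where $A_d(\tau)\coloneqq\big(I+\tfrac{\tau}{2}A\big)\big(I-\tfrac{\tau}{2}A\big)^{-1}$. Then: (i) for each $0<\alpha<1$ there exists $K>0$ such that $\|x_n\|\le K n^{-\alpha/2}\|(-A)^{\alpha}x_0\|$ for all $x_0\in D((-A)^{\alpha})$ and all $n\ge1$; (ii) there exists $K>0$ such that $\|x_n\|\le K\sqrt{\tfrac{\log n}{n}}\,\|Ax_0\|$ for all $x_0\in D(A)$ and all $n\ge2$.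
   Context: $\mathbb{N}_0=\{0,1,2,\dots\}$. An exponentially stable $C_0$-semigroup satisfies $\|e^{At}\|\le Ke^{-\omega t}$ for some $K,\omega>0$; then $A^{-1}\in\mathcal{L}(H)$. $A_d(\tau)$ is the Cayley transform of $A$ (Crank–Nicolson scheme with step size $\tau$). $(-A)^{\alpha}$, $\alpha>0$, denotes the fractional power of $-A$ with domain $D((-A)^{\alpha})$. *)

theory Defs
  imports "HOL-Analysis.Analysis"
begin

definition C0_semigroup :: "(real \<Rightarrow> 'a::real_normed_vector \<Rightarrow> 'a) \<Rightarrow> bool" where
  "C0_semigroup T \<longleftrightarrow>
     (\<forall>t\<ge>0. bounded_linear (T t)) \<and> T 0 = id \<and>
     (\<forall>s\<ge>0. \<forall>t\<ge>0. T (s + t) = T s \<circ> T t) \<and>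
     (\<forall>x. ((\<lambda>t. T t x) \<longlongrightarrow> x) (at_right 0))"

definition gen_dom :: "(real \<Rightarrow> 'a::real_normed_vector \<Rightarrow> 'a) \<Rightarrow> 'a set" where
  "gen_dom T = {x. \<exists>y. ((\<lambda>h. (T h x - x) /\<^sub>R h) \<longlongrightarrow> y) (at_right 0)}"

(* the infinitesimal generator (meaningful on gen_dom T) *)
definition gen :: "(real \<Rightarrow> 'a::real_normed_vector \<Rightarrow> 'a) \<Rightarrow> 'a \<Rightarrow> 'a" where
  "gen T x = Lim (at_right 0) (\<lambda>h. (T h x - x) /\<^sub>R h)"

definition exp_stable :: "(real \<Rightarrow> 'a::real_normed_vector \<Rightarrow> 'a) \<Rightarrow> bool" where
  "exp_stable T \<longleftrightarrow> (\<exists>K \<omega>. K > 0 \<and> \<omega> > 0 \<and> (\<forall>t\<ge>0. onorm (T t) \<le> K * exp (- \<omega> * t)))"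

definition bounded_semigroup :: "(real \<Rightarrow> 'a::real_normed_vector \<Rightarrow> 'a) \<Rightarrow> bool" where
  "bounded_semigroup T \<longleftrightarrow> (\<exists>M. \<forall>t\<ge>0. onorm (T t) \<le> M)"

definition gen_inv :: "(real \<Rightarrow> 'a::real_normed_vector \<Rightarrow> 'a) \<Rightarrow> 'a \<Rightarrow> 'a" where
  "gen_inv T y = (THE x. x \<in> gen_dom T \<and> gen T x = y)"

definition cayley :: "(real \<Rightarrow> 'a::real_normed_vector \<Rightarrow> 'a) \<Rightarrow> real \<Rightarrow> 'a \<Rightarrow> 'a" where
  "cayley T \<tau> x =
     (let z = (THE z. z \<in> gen_dom T \<and> z - (\<tau> / 2) *\<^sub>R gen T z = x)
      in z + (\<tau> / 2) *\<^sub>R gen T z)"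

(* negative fractional power (-A)^{-alpha} = 1/Gamma(alpha) int_0^infty t^(alpha-1) T(t) dt
   (Pazy, Sect. 2.6, for exponentially stable semigroups) *)
definition frac_neg_pow :: "(real \<Rightarrow> 'a::real_normed_vector \<Rightarrow> 'a) \<Rightarrow> real \<Rightarrow> 'a \<Rightarrow> 'a" where
  "frac_neg_pow T \<alpha> x = (1 / Gamma \<alpha>) *\<^sub>R integral {0..} (\<lambda>t. (t powr (\<alpha> - 1)) *\<^sub>R T t x)"

definition frac_dom :: "(real \<Rightarrow> 'a::real_normed_vector \<Rightarrow> 'a) \<Rightarrow> real \<Rightarrow> 'a set" where
  "frac_dom T \<alpha> = range (frac_neg_pow T \<alpha>)"

definition frac_pow :: "(real \<Rightarrow> 'a::real_normed_vector \<Rightarrow> 'a) \<Rightarrow> real \<Rightarrow> 'a \<Rightarrow> 'a" where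
  "frac_pow T \<alpha> x = (THE y. frac_neg_pow T \<alpha> y = x)"

end

theory Submission
  imports Defs
begin

text \<open>Write \<open>x\<^sub>n = z\<^sub>n - (\<tau>\<^sub>n/2) A z\<^sub>n\<close> and \<open>x\<^sub>n\<^sub>+\<^sub>1 = z\<^sub>n + (\<tau>\<^sub>n/2) A z\<^sub>n\<close>.  Exponential stability
  gives the Lyapunov function \<open>V(x) = \<integral>\<^sub>0\<^sup>L \<parallel>e\<^sup>A\<^sup>t x\<parallel>\<^sup>2 dt\<close>, which decreases by at least a multiple of
  \<open>\<parallel>z\<^sub>n\<parallel>\<^sup>2\<close> in each step, whatever the step size.  Boundedness of the semigroup \<open>S\<close> of \<open>A\<^sup>-\<^sup>1\<close> gives
  \<open>Q(x) = \<integral>\<^sub>0\<^sup>L e\<^sup>-\<^sup>2\<^sup>r\<^sup>t \<parallel>S(t) x\<parallel>\<^sup>2 dt\<close>, which with \<open>r\<close> of order \<open>1/N\<close> controls \<open>\<parallel>A z\<^sub>n\<parallel>\<^sup>2\<close> up to step \<open>N\<close>.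
  Hence \<open>\<Sum>\<^sub>k\<^sub>\<le>\<^sub>N \<parallel>x\<^sub>k\<parallel>\<^sup>2\<close> is \<open>O(N \<parallel>x\<^sub>0\<parallel>\<^sup>2)\<close>, and \<open>O(\<parallel>A x\<^sub>0\<parallel>\<^sup>2)\<close> when \<open>x\<^sub>0\<close> lies in \<open>D(A)\<close>, because \<open>V\<close> can be
  applied to the trajectory \<open>A x\<^sub>n\<close>.  The adjoint scheme obeys the first bound too, and pairing the two
  trajectories turns the sums into \<open>\<parallel>x\<^sub>n\<parallel> = O(\<parallel>x\<^sub>0\<parallel>)\<close> and \<open>\<parallel>x\<^sub>n\<parallel> = O(n\<^sup>-\<^sup>1\<^sup>/\<^sup>2 \<parallel>A x\<^sub>0\<parallel>)\<close>; the second rate has no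
  logarithm.  Interpolation between these two bounds gives the fractional powers.\<close>

section \<open>Hilbert spaces\<close>

text \<open>With varying steps the trajectory is not given by powers of one operator, and a single
  step need not be a contraction. Forms of the type int |X(t) x|^2 dt suit the scheme because, with
  B = A^-1, consecutive iterates are B w - s w and B w + s w. Their squares cancel in the difference
  of the form, and what remains is 4 s times the mixed term of B w and w, which is a total
  derivative in t. The form built from e^(At) sees only B w, the midpoint of the two iterates. To
  see w = A z, the roles of A and A^-1 are exchanged, in line with (I + sA)(I - sA)^-1 = -(I + s^-1
  A^-1)(I - s^-1 A^-1)^-1. The semigroup of A^-1 is only bounded, hence the damping rate and the
  factor N. Interpolation acts on the initial value: (-A)^-\<alpha> y is split into a small vector
  of H and a vector of D(A), with a cut that depends on n, and each part is propagated separately.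
  Since \<open>frac_pow\<close> is a definite description, the injectivity of (-A)^-\<alpha> has to
  be proved as well; this is an Abel inversion.\<close>

lemma orthogonal_projection_exists:
  fixes M :: "'a::{real_inner, complete_space} set"
  assumes sub: "subspace M" and cl: "closed M"
  obtains p where "p \<in> M" "\<And>m. m \<in> M \<Longrightarrow> inner (x - p) m = 0"
proof -
  define D where "D = (\<lambda>m. (norm (x - m))\<^sup>2) ` M"
  define d where "d = Inf D"
  have "0 \<in> M" using sub by (rule subspace_0)
  then have Dne: "D \<noteq> {}" by (auto simp: D_def)
  have bdd: "bdd_below D" by (auto simp: D_def intro!: bdd_belowI[of _ 0])
  have d_le: "d \<le> (norm (x - m))\<^sup>2" if "m \<in> M" for m
    unfolding d_def using that by (intro cInf_lower bdd) (auto simp: D_def)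
  have "\<exists>m\<in>M. (norm (x - m))\<^sup>2 < d + 1 / real (Suc n)" for n
  proof -
    have "Inf D < d + 1 / real (Suc n)" by (simp add: d_def)
    then show ?thesis using cInf_less_iff[OF Dne bdd] by (auto simp: D_def)
  qed
  then obtain a where aM: "\<And>n. a n \<in> M" and a: "\<And>n. (norm (x - a n))\<^sup>2 < d + 1 / real (Suc n)"
    by metis
  have close: "(norm (a i - a j))\<^sup>2 \<le> 4 / real (Suc N)" if "N \<le> i" "N \<le> j" for i j N
  proof -
    have par: "(norm (a i - a j))\<^sup>2 = 2 * (norm (x - a i))\<^sup>2 + 2 * (norm (x - a j))\<^sup>2
        - 4 * (norm (x - (1/2) *\<^sub>R (a i + a j)))\<^sup>2"
      by (simp add: power2_norm_eq_inner inner_diff inner_add inner_commute algebra_simps)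
    have "(1/2) *\<^sub>R (a i + a j) \<in> M"
      using sub aM by (intro subspace_mul subspace_add)
    then have "d \<le> (norm (x - (1/2) *\<^sub>R (a i + a j)))\<^sup>2" by (rule d_le)
    moreover have "1 / real (Suc i) \<le> 1 / real (Suc N)" "1 / real (Suc j) \<le> 1 / real (Suc N)"
      using that by (auto simp: field_simps)
    ultimately show ?thesis using par a[of i] a[of j] by linarith
  qed
  have "Cauchy a"
  proof (rule metric_CauchyI)
    fix e :: real assume e: "e > 0"
    obtain N where N: "4 / e\<^sup>2 < real N" using reals_Archimedean2 by blast
    have "dist (a i) (a j) < e" if "N \<le> i" "N \<le> j" for i j
    proof -
      have "4 / real (Suc N) < e\<^sup>2"
        using N e by (simp add: field_simps) (smt (verit) zero_less_power)
      then have "(norm (a i - a j))\<^sup>2 < e\<^sup>2" using close[OF that] by linarith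
      then show ?thesis using e by (simp add: dist_norm power2_less_imp_less)
    qed
    then show "\<exists>N. \<forall>m\<ge>N. \<forall>n\<ge>N. dist (a m) (a n) < e" by blast
  qed
  then obtain p where p: "a \<longlonglongrightarrow> p" using Cauchy_convergent convergent_def by blast
  have pM: "p \<in> M" using closed_sequentially[OF cl] aM p by blast
  have "(\<lambda>n. (norm (x - a n))\<^sup>2) \<longlonglongrightarrow> (norm (x - p))\<^sup>2" by (intro tendsto_intros p)
  moreover have "(\<lambda>n. d + 1 / real (Suc n)) \<longlonglongrightarrow> d + 0"
    by (intro tendsto_intros LIMSEQ_Suc lim_1_over_n)
  ultimately have pd: "(norm (x - p))\<^sup>2 \<le> d"
    using a by (intro LIMSEQ_le[where X="\<lambda>n. (norm (x - a n))\<^sup>2" and Y="\<lambda>n. d + 1 / real (Suc n)"])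
      (auto intro: less_imp_le)
  have "inner (x - p) m = 0" if m: "m \<in> M" for m
  proof (cases "m = 0")
    case False
    \<comment> \<open>The minimiser of |x - p - t m|^2 over t; a strict gain there would contradict
      the minimality of p.\<close>
    define t where "t = inner (x - p) m / inner m m"
    have mm: "inner m m > 0" using False by simp
    have "p + t *\<^sub>R m \<in> M" using sub pM m by (intro subspace_mul subspace_add)
    then have "(norm (x - p))\<^sup>2 \<le> (norm ((x - p) - t *\<^sub>R m))\<^sup>2"
      using order_trans[OF pd d_le[of "p + t *\<^sub>R m"]] by (simp add: diff_diff_eq)
    also have "\<dots> = (norm (x - p))\<^sup>2 - 2 * t * inner (x - p) m + t * t * inner m m"
      unfolding power2_norm_eq_inner
      by (simp add: inner_diff_left[of "x - p"] inner_diff_right[of _ "x - p"] inner_commute algebra_simps)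
    also have "t * t * inner m m = t * inner (x - p) m" using mm by (simp add: t_def)
    finally have "t * inner (x - p) m \<le> 0" by simp
    then have "(inner (x - p) m)\<^sup>2 \<le> 0" using mm by (simp add: t_def power2_eq_square divide_le_0_iff)
    then show ?thesis by simp
  qed simp
  with pM that show thesis by blast
qed

lemma riesz_representation:
  fixes f :: "'a::{real_inner, complete_space} \<Rightarrow> real"
  assumes "bounded_linear f"
  obtains y where "\<And>x. f x = inner x y"
proof (cases "\<forall>x. f x = 0")
  case True
  then show thesis using that[of 0] by simp
next
  case False
  interpret f: bounded_linear f by fact
  obtain x where x: "f x \<noteq> 0" using False by blast
  have "subspace (f -` {0})" by (simp add: subspace_def f.add f.scaleR f.zero)
  moreover have "closed (f -` {0})"
    by (intro closed_vimage) (auto intro: f.continuous_on continuous_on_id)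
  ultimately obtain p where p: "f p = 0" and orth: "\<And>m. f m = 0 \<Longrightarrow> inner (x - p) m = 0"
    using orthogonal_projection_exists[of "f -` {0}" x] by auto
  define u where "u = x - p"
  have fu: "f u \<noteq> 0" using x p by (simp add: u_def f.diff)
  then have uu: "inner u u \<noteq> 0" using f.zero by auto
  have "f y = inner y ((f u / inner u u) *\<^sub>R u)" for y
  proof -
    have "inner u (f u *\<^sub>R y - f y *\<^sub>R u) = 0"
      unfolding u_def[symmetric] using orth[of "f u *\<^sub>R y - f y *\<^sub>R u"]
      by (simp add: f.diff f.scaleR u_def)
    then have "f u * inner y u = f y * inner u u" by (simp add: inner_diff_right inner_commute)
    then show ?thesis using uu by (simp add: field_simps)
  qed
  then show thesis using that by blast
qed

lemma norm_le_if_inner_le: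
  fixes x :: "'a::real_inner"
  assumes "\<And>u. \<bar>inner u x\<bar> \<le> c * norm u" "c \<ge> 0"
  shows "norm x \<le> c"
proof (cases "x = 0")
  case False
  have "norm x * norm x \<le> c * norm x"
    using assms(1)[of x] by (simp add: power2_eq_square flip: power2_norm_eq_inner)
  then show ?thesis using False by simp
qed (simp add: assms)

text \<open>\<open>adjoint\<close> is defined by choice, so its identity holds once some witness
  exists; the Riesz vectors of the functionals u -> <f u, v> form one.\<close>

lemma hilbert_adjoint:
  fixes f :: "'a::{real_inner, complete_space} \<Rightarrow> 'a"
  assumes "bounded_linear f"
  shows "inner (f u) v = inner u (adjoint f v)"
proof -
  have "\<exists>w. \<forall>u. inner (f u) v = inner u w" for v
    using riesz_representation[OF bounded_linear_compose[OF bounded_linear_inner_left assms], of v]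
    by metis
  then obtain g where "\<forall>u v. inner (f u) v = inner u (g v)" by metis
  then show ?thesis using adjoint_unique by metis
qed

lemma eq_if_inner_eq:
  fixes x y :: "'a::real_inner"
  assumes "\<And>u. inner u x = inner u y"
  shows "x = y"
  using assms[of "x - y"] by (metis inner_diff_right inner_eq_zero_iff right_minus_eq)

lemma linear_hilbert_adjoint:
  fixes f :: "'a::{real_inner, complete_space} \<Rightarrow> 'a"
  assumes "bounded_linear f"
  shows "linear (adjoint f)"
  by (rule linearI; rule eq_if_inner_eq)
    (simp_all add: inner_add_right flip: hilbert_adjoint[OF assms])

lemma norm_hilbert_adjoint_le:
  fixes f :: "'a::{real_inner, complete_space} \<Rightarrow> 'a"
  assumes "bounded_linear f" "\<And>x. norm (f x) \<le> c * norm x" "c \<ge> 0"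
  shows "norm (adjoint f v) \<le> c * norm v"
proof (rule norm_le_if_inner_le)
  fix u
  have "\<bar>inner (f u) v\<bar> \<le> norm (f u) * norm v" by (rule Cauchy_Schwarz_ineq2)
  also have "\<dots> \<le> c * norm u * norm v" using assms(2) by (intro mult_right_mono) auto
  finally show "\<bar>inner u (adjoint f v)\<bar> \<le> c * norm v * norm u"
    by (simp add: mult_ac flip: hilbert_adjoint[OF assms(1)])
qed (use assms in auto)

lemma subspace_closure:
  fixes S :: "'a::real_normed_vector set"
  assumes S: "subspace S"
  shows "subspace (closure S)"
proof (rule subspaceI)
  show "0 \<in> closure S" using subspace_0[OF S] closure_subset by blast
next
  fix x y assume "x \<in> closure S" "y \<in> closure S"
  then obtain f g where "\<And>n. f n \<in> S" "\<And>n. g n \<in> S" "f \<longlonglongrightarrow> x" "g \<longlonglongrightarrow> y"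
    unfolding closure_sequential by blast
  then show "x + y \<in> closure S"
    unfolding closure_sequential
    by (intro exI[of _ "\<lambda>n. f n + g n"] conjI allI tendsto_add subspace_add[OF S])
next
  fix c :: real and x assume "x \<in> closure S"
  then obtain f where "\<And>n. f n \<in> S" "f \<longlonglongrightarrow> x"
    unfolding closure_sequential by blast
  then show "c *\<^sub>R x \<in> closure S"
    unfolding closure_sequential
    by (intro exI[of _ "\<lambda>n. c *\<^sub>R f n"] conjI allI tendsto_intros subspace_scale[OF S])
qed

text \<open>Whatever is orthogonal to the range of the adjoint lies in the kernel of f, so the
  residual of the projection onto the closed range vanishes. This serves both the solvability of the
  implicit step and the continuity of adjoint orbits.\<close>

lemma dense_range_adjoint:
  fixes f :: "'a::{real_inner, complete_space} \<Rightarrow> 'a"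
  assumes f: "bounded_linear f" and inj: "\<And>u. f u = 0 \<Longrightarrow> u = 0"
  shows "closure (range (adjoint f)) = UNIV"
proof -
  have "subspace (closure (range (adjoint f)))"
    using linear_hilbert_adjoint[OF f] by (intro subspace_closure linear_subspace_image subspace_UNIV)
  note proj = orthogonal_projection_exists[OF this closed_closure]
  have "x \<in> closure (range (adjoint f))" for x
  proof -
    obtain p where p: "p \<in> closure (range (adjoint f))"
      and orth: "\<And>m. m \<in> closure (range (adjoint f)) \<Longrightarrow> inner (x - p) m = 0"
      using proj[of x] by blast
    have "inner (f (x - p)) v = 0" for v
      using orth[of "adjoint f v"] subsetD[OF closure_subset, of "adjoint f v"]
      by (simp add: hilbert_adjoint[OF f])
    then have "f (x - p) = 0" using inner_eq_zero_iff[of "f (x - p)"] by simp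
    then have "x - p = 0" by (rule inj)
    then show ?thesis using p by simp
  qed
  then show ?thesis by blast
qed

section \<open>Vector-valued antiderivatives and improper integrals\<close>

lemma riesz_map:
  obtains R :: "('a::{real_inner, complete_space} \<Rightarrow>\<^sub>L real) \<Rightarrow> 'a"
  where "bounded_linear R" "\<And>x. R (blinfun_inner_left x) = x"
proof -
  have "\<exists>y. \<forall>x. blinfun_apply \<phi> x = inner x y" for \<phi> :: "'a \<Rightarrow>\<^sub>L real"
    using riesz_representation[of "blinfun_apply \<phi>"] blinfun.bounded_linear_right by metis
  then obtain R :: "('a \<Rightarrow>\<^sub>L real) \<Rightarrow> 'a" where R: "\<And>\<phi> x. blinfun_apply \<phi> x = inner x (R \<phi>)"
    by metis
  have "bounded_linear R"
  proof (rule bounded_linear_intro[where K=1])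
    show "R (\<phi> + \<psi>) = R \<phi> + R \<psi>" for \<phi> \<psi>
      by (rule eq_if_inner_eq) (simp add: inner_add_right blinfun.add_left flip: R)
    show "R (c *\<^sub>R \<phi>) = c *\<^sub>R R \<phi>" for c \<phi>
      by (rule eq_if_inner_eq) (simp add: blinfun.scaleR_left flip: R)
    show "norm (R \<phi>) \<le> norm \<phi> * 1" for \<phi>
      using norm_blinfun[of \<phi>] by (intro norm_le_if_inner_le) (simp_all flip: R)
  qed
  moreover have "R (blinfun_inner_left x) = x" for x
    by (rule eq_if_inner_eq) (simp add: inner_commute flip: R)
  ultimately show thesis using that by blast
qed

text \<open>The fundamental theorem of calculus in the library needs the class \<open>banach\<close>, which the
  sort \<open>{real_inner, complete_space}\<close> does not entail.  The dual space is in that class, and the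
  Riesz map carries antiderivatives back.\<close>

lemma hilbert_antiderivative:
  fixes f :: "real \<Rightarrow> 'a::{real_inner, complete_space}"
  assumes f: "continuous_on {0..} f"
  obtains F where "F 0 = 0" "\<And>t. t \<ge> 0 \<Longrightarrow> (F has_vector_derivative f t) (at t within {0..})"
proof -
  obtain R :: "('a \<Rightarrow>\<^sub>L real) \<Rightarrow> 'a" where R: "bounded_linear R" "\<And>x. R (blinfun_inner_left x) = x"
    using riesz_map by blast
  define g where "g t = blinfun_inner_left (f t)" for t
  have g: "continuous_on {0..} g" unfolding g_def
    by (rule bounded_linear.continuous_on[OF bounded_linear_blinfun_inner_left f])
  define F where "F t = R (integral {0..t} g)" for t
  have "(F has_vector_derivative f t) (at t within {0..})" if t: "t \<ge> 0" for t
  proof -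
    have "((\<lambda>u. integral {0..u} g) has_vector_derivative g t) (at t within {0..t+1})"
      using t by (intro integral_has_vector_derivative continuous_on_subset[OF g]) auto
    then have "(F has_vector_derivative R (g t)) (at t within {0..t+1})"
      unfolding F_def by (rule bounded_linear.has_vector_derivative[OF R(1)])
    moreover have "at t within {0..t+1} = at t within {0..}"
      using t by (intro at_within_nhd[of _ "{..<t+1}"]) auto
    ultimately show ?thesis by (simp add: g_def R(2))
  qed
  moreover have "F 0 = 0" by (simp add: F_def linear_0 bounded_linear.linear[OF R(1)])
  ultimately show thesis using that by blast
qed

lemma vector_derivative_zero_const:
  fixes F :: "real \<Rightarrow> 'a::real_normed_vector"
  assumes "a \<le> b" "continuous_on {a..b} F"
    and "\<And>t. a < t \<Longrightarrow> t < b \<Longrightarrow> (F has_vector_derivative 0) (at t)"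
  shows "F b = F a"
proof (cases "a < b")
  case True
  have "norm (F b - F a) \<le> (0::real) - 0"
    using assms by (intro differentiable_bound_general[OF True, of F "\<lambda>_. 0" "\<lambda>_. 0" "\<lambda>_. 0"]) auto
  then show ?thesis by simp
qed (use assms in simp)

lemma has_vector_derivative_at_within_Ici:
  fixes f :: "real \<Rightarrow> 'a::real_normed_vector"
  assumes "(f has_vector_derivative f') (at t within {0..})" "0 < t"
  shows "(f has_vector_derivative f') (at t)"
  using assms at_within_interior[of t "{0..}"] by simp

text \<open>Hake's theorem on a half-line: convergence of the antiderivative suffices, without
  absolute integrability.\<close>

lemma has_integral_Ici_if_tendsto:
  fixes F f :: "real \<Rightarrow> 'a::banach"
  assumes F: "continuous_on {0..} F" "F 0 = 0"
    and D: "\<And>t. t > 0 \<Longrightarrow> (F has_vector_derivative f t) (at t)"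
    and lim: "(F \<longlongrightarrow> I) at_top"
  shows "(f has_integral I) {0..}"
proof -
  have ne: "\<not> (\<exists>a b. {0::real..} = cbox a b)"
  proof safe
    fix a b :: real assume "{0..} = cbox a b"
    moreover have "\<bar>b\<bar> + 1 \<in> {0..}" "\<bar>b\<bar> + 1 \<notin> cbox a b" by auto
    ultimately show False by blast
  qed
  have fin: "(f has_integral F b) {0..b}" if "b \<ge> 0" for b
  proof -
    have "(f has_integral F b - F 0) {0..b}"
      using that by (intro fundamental_theorem_of_calculus_interior continuous_on_subset[OF F(1)] D) auto
    then show ?thesis by (simp add: F(2))
  qed
  show ?thesis
  proof (subst has_integral_alt, subst if_not_P[OF ne], intro allI impI)
    fix e :: real assume "e > 0"
    then have "eventually (\<lambda>b. dist (F b) I < e) at_top" using lim by (simp add: tendstoD)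
    then obtain b0 where b0: "\<And>b. b \<ge> b0 \<Longrightarrow> norm (F b - I) < e"
      by (auto simp: eventually_at_top_linorder dist_norm)
    have "\<exists>z. ((\<lambda>x. if x \<in> {0..} then f x else 0) has_integral z) (cbox a b) \<and> norm (z - I) < e"
      \<comment> \<open>This radius puts 0 and |b0| into the box, so the box reaches past
        \<open>b0\<close> on the right and its part on the half-line is exactly [0, b].\<close>
      if ab: "ball 0 (\<bar>b0\<bar> + 1) \<subseteq> cbox a b" for a b
    proof -
      have "b0 \<le> b" "a \<le> 0" "0 \<le> b"
        using ab subsetD[OF ab, of "\<bar>b0\<bar>"] subsetD[OF ab, of 0] by (auto simp: dist_norm)
      then have "((\<lambda>x. if x \<in> {0..b} then f x else 0) has_integral F b) {a..b}"
        using has_integral_restrict_closed_subinterval[of f "F b" 0 b a b] fin[of b] by simp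
      then have "((\<lambda>x. if x \<in> {0..} then f x else 0) has_integral F b) {a..b}"
        by (rule has_integral_eq[rotated]) auto
      then show ?thesis using b0[OF \<open>b0 \<le> b\<close>] by auto
    qed
    then show "\<exists>B>0. \<forall>a b. ball 0 B \<subseteq> cbox a b \<longrightarrow>
        (\<exists>z. ((\<lambda>x. if x \<in> {0..} then f x else 0) has_integral z) (cbox a b) \<and> norm (z - I) < e)"
      by (intro exI[of _ "\<bar>b0\<bar> + 1"]) auto
  qed
qed

lemma hilbert_has_integral_Ici_if_tendsto:
  fixes F f :: "real \<Rightarrow> 'a::{real_inner, complete_space}"
  assumes F: "continuous_on {0..} F" "F 0 = 0"
    and D: "\<And>t. t > 0 \<Longrightarrow> (F has_vector_derivative f t) (at t)"
    and lim: "(F \<longlongrightarrow> I) at_top"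
  shows "(f has_integral I) {0..}"
proof -
  obtain R :: "('a \<Rightarrow>\<^sub>L real) \<Rightarrow> 'a" where R: "bounded_linear R" "\<And>x. R (blinfun_inner_left x) = x"
    using riesz_map by blast
  note bl = bounded_linear_blinfun_inner_left
  have "((\<lambda>t. blinfun_inner_left (f t)) has_integral blinfun_inner_left I) {0..}"
  proof (rule has_integral_Ici_if_tendsto)
    show "continuous_on {0..} (\<lambda>t. blinfun_inner_left (F t))"
      by (rule bounded_linear.continuous_on[OF bl F(1)])
    show "blinfun_inner_left (F 0) = 0" by (simp add: F(2) linear_0 bounded_linear.linear[OF bl])
    show "((\<lambda>t. blinfun_inner_left (F t)) has_vector_derivative blinfun_inner_left (f t)) (at t)"
      if "t > 0" for t
      by (rule bounded_linear.has_vector_derivative[OF bl D[OF that]])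
    show "((\<lambda>t. blinfun_inner_left (F t)) \<longlongrightarrow> blinfun_inner_left I) at_top"
      by (rule bounded_linear.tendsto[OF bl lim])
  qed
  from has_integral_linear[OF this R(1)] show ?thesis by (simp add: o_def R(2))
qed

section \<open>Semigroups and their generators\<close>

locale bounded_C0_semigroup =
  fixes T :: "real \<Rightarrow> 'a::{real_inner, complete_space} \<Rightarrow> 'a" and M :: real
  assumes C0: "C0_semigroup T"
    and norm_le: "t \<ge> 0 \<Longrightarrow> norm (T t x) \<le> M * norm x"
    and M_ge_0: "M \<ge> 0"
begin

lemma bl: "t \<ge> 0 \<Longrightarrow> bounded_linear (T t)"
  and T_0: "T 0 x = x"
  and T_add: "s \<ge> 0 \<Longrightarrow> t \<ge> 0 \<Longrightarrow> T (s + t) x = T s (T t x)"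
  and T_right: "((\<lambda>t. T t x) \<longlongrightarrow> x) (at_right 0)"
  using C0 by (auto simp: C0_semigroup_def)

lemma T_linear: "t \<ge> 0 \<Longrightarrow> linear (T t)"
  by (rule bounded_linear.linear[OF bl])

text \<open>Only right continuity at 0 is given. The bound M transports it to every s, uniformly in
  s, and this uniformity covers approach from the left as well.\<close>

lemma orbit_continuous: "continuous_on {0..} (\<lambda>t. T t x)"
  unfolding continuous_on_iff
proof (intro ballI allI impI)
  fix t e :: real assume t: "t \<in> {0..}" and e: "e > 0"
  have "eventually (\<lambda>h. dist (T h x) x < e / (M + 1)) (at_right 0)"
    using e M_ge_0 by (intro tendstoD[OF T_right]) auto
  then obtain d where d: "d > 0" "\<And>h. 0 < h \<Longrightarrow> h < d \<Longrightarrow> norm (T h x - x) < e / (M + 1)"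
    by (auto simp: eventually_at_right_field dist_norm)
  have *: "norm (T (s + h) x - T s x) < e" if "s \<ge> 0" "0 < h" "h < d" for s h
  proof -
    have "norm (T (s + h) x - T s x) = norm (T s (T h x - x))"
      using that by (simp add: T_add linear_diff[OF T_linear])
    also have "\<dots> \<le> M * norm (T h x - x)" using that by (intro norm_le)
    also have "\<dots> \<le> M * (e / (M + 1))"
      using d(2)[OF that(2,3)] M_ge_0 by (intro mult_left_mono) auto
    also have "\<dots> < e" using e M_ge_0 by (simp add: field_simps)
    finally show ?thesis .
  qed
  have "dist (T s x) (T t x) < e" if "s \<in> {0..}" "dist s t < d" for s
    using *[of t "s - t"] *[of s "t - s"] that t e
    by (cases s t rule: linorder_cases) (auto simp: dist_norm norm_minus_commute)
  then show "\<exists>d>0. \<forall>s\<in>{0..}. dist s t < d \<longrightarrow> dist (T s x) (T t x) < e" using d(1) by blast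
qed

lemma gen_tendsto:
  assumes "x \<in> gen_dom T"
  shows "((\<lambda>h. (T h x - x) /\<^sub>R h) \<longlongrightarrow> gen T x) (at_right 0)"
  using assms tendsto_Lim[OF trivial_limit_at_right_real] unfolding gen_dom_def gen_def by blast

lemma gen_eqI:
  assumes "((\<lambda>h. (T h x - x) /\<^sub>R h) \<longlongrightarrow> y) (at_right 0)"
  shows "x \<in> gen_dom T" "gen T x = y"
  using assms tendsto_Lim[OF trivial_limit_at_right_real assms] unfolding gen_dom_def gen_def by auto

lemma gen_semigroup_commute:
  assumes "x \<in> gen_dom T" "s \<ge> 0"
  shows "T s x \<in> gen_dom T" "gen T (T s x) = T s (gen T x)"
proof -
  have "((\<lambda>h. T s ((T h x - x) /\<^sub>R h)) \<longlongrightarrow> T s (gen T x)) (at_right 0)"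
    by (rule bounded_linear.tendsto[OF bl[OF assms(2)] gen_tendsto[OF assms(1)]])
  moreover have "\<forall>\<^sub>F h in at_right 0. T s ((T h x - x) /\<^sub>R h) = (T h (T s x) - T s x) /\<^sub>R h"
    using eventually_at_right_less[of "0::real"]
  proof eventually_elim
    case (elim h)
    then show ?case
      using assms(2) T_add[of s h x] T_add[of h s x]
      by (simp add: linear_diff[OF T_linear] linear_scale[OF T_linear] add.commute)
  qed
  ultimately have "((\<lambda>h. (T h (T s x) - T s x) /\<^sub>R h) \<longlongrightarrow> T s (gen T x)) (at_right 0)"
    using tendsto_cong by fast
  then show "T s x \<in> gen_dom T" "gen T (T s x) = T s (gen T x)" by (rule gen_eqI)+
qed

lemma gen_linear:
  assumes "x \<in> gen_dom T" "y \<in> gen_dom T"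
  shows "a *\<^sub>R x + b *\<^sub>R y \<in> gen_dom T" "gen T (a *\<^sub>R x + b *\<^sub>R y) = a *\<^sub>R gen T x + b *\<^sub>R gen T y"
proof -
  have "((\<lambda>h. a *\<^sub>R ((T h x - x) /\<^sub>R h) + b *\<^sub>R ((T h y - y) /\<^sub>R h)) \<longlongrightarrow> a *\<^sub>R gen T x + b *\<^sub>R gen T y)
      (at_right 0)"
    by (intro tendsto_intros gen_tendsto assms)
  moreover have "\<forall>\<^sub>F h in at_right 0. a *\<^sub>R ((T h x - x) /\<^sub>R h) + b *\<^sub>R ((T h y - y) /\<^sub>R h)
      = (T h (a *\<^sub>R x + b *\<^sub>R y) - (a *\<^sub>R x + b *\<^sub>R y)) /\<^sub>R h"
    using eventually_at_right_less[of "0::real"]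
    by eventually_elim
      (simp add: linear_add[OF T_linear] linear_scale[OF T_linear] algebra_simps)
  ultimately have "((\<lambda>h. (T h (a *\<^sub>R x + b *\<^sub>R y) - (a *\<^sub>R x + b *\<^sub>R y)) /\<^sub>R h)
      \<longlongrightarrow> a *\<^sub>R gen T x + b *\<^sub>R gen T y) (at_right 0)"
    using tendsto_cong by fast
  then show "a *\<^sub>R x + b *\<^sub>R y \<in> gen_dom T"
    "gen T (a *\<^sub>R x + b *\<^sub>R y) = a *\<^sub>R gen T x + b *\<^sub>R gen T y" by (rule gen_eqI)+
qed

text \<open>To the right of t the difference quotient is T(t) applied to the one at 0. To the left
  the base point is s = t - h, so the quotient approximates T(s) g instead of T(t) g, and continuity
  of the orbit of g pays for the difference; each of the two errors gets e/2.\<close>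

lemma orbit_derivative:
  assumes x: "x \<in> gen_dom T" and t: "t \<ge> 0"
  shows "((\<lambda>t. T t x) has_vector_derivative T t (gen T x)) (at t within {0..})"
  unfolding has_vector_derivative_def has_derivative_within_alt
proof (intro conjI allI impI bounded_linear_scaleR_left)
  fix e :: real assume e: "e > 0"
  define g where "g = gen T x"
  define e1 where "e1 = e / (2 * (M + 1))"
  have e1: "e1 > 0" "M * e1 \<le> e / 2" using e M_ge_0 by (auto simp: e1_def field_simps)
  have "eventually (\<lambda>h. dist ((T h x - x) /\<^sub>R h) g < e1) (at_right 0)"
    unfolding g_def by (intro tendstoD[OF gen_tendsto[OF x]] e1)
  then obtain d1 where d1: "d1 > 0"
    "\<And>h. 0 < h \<Longrightarrow> h < d1 \<Longrightarrow> norm ((T h x - x) /\<^sub>R h - g) < e1"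
    unfolding eventually_at_right_field dist_norm by blast
  have d1': "norm (T h x - x - h *\<^sub>R g) \<le> e1 * h" if "0 < h" "h < d1" for h
  proof -
    have "norm (T h x - x - h *\<^sub>R g) = h * norm ((T h x - x) /\<^sub>R h - g)"
    proof -
      have "T h x - x - h *\<^sub>R g = h *\<^sub>R ((T h x - x) /\<^sub>R h - g)"
        using that(1) by (simp add: scaleR_diff_right)
      then show ?thesis using that(1) by (metis abs_of_pos norm_scaleR)
    qed
    also have "\<dots> \<le> h * e1" using d1(2)[OF that] that(1) by (intro mult_left_mono) auto
    finally show ?thesis by (simp add: mult.commute)
  qed
  obtain d2 where d2: "d2 > 0"
    "\<And>s. s \<ge> 0 \<Longrightarrow> dist s t < d2 \<Longrightarrow> norm (T s g - T t g) < e / 2"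
    using orbit_continuous[of g, unfolded continuous_on_iff, rule_format, of t "e/2"] t e
    by (auto simp: dist_norm)
  have "norm (T s x - T t x - (s - t) *\<^sub>R T t g) \<le> e * norm (s - t)"
    if s: "s \<ge> 0" "norm (s - t) < min d1 d2" for s
  proof (cases s t rule: linorder_cases)
    case greater
    define h where "h = s - t"
    have h: "0 < h" "h < d1" "s = t + h" using greater s by (auto simp: h_def)
    have "norm (T s x - T t x - h *\<^sub>R T t g) = norm (T t (T h x - x - h *\<^sub>R g))"
      using h t by (simp add: T_add linear_diff[OF T_linear] linear_scale[OF T_linear])
    also have "\<dots> \<le> M * (e1 * h)"
      using norm_le[OF t] mult_left_mono[OF d1'[OF h(1,2)] M_ge_0] by (rule order_trans)
    also have "\<dots> \<le> e * h"
      using mult_right_mono[OF e1(2), of h] h e by (simp add: mult.assoc)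
    finally show ?thesis using h by simp
  next
    case less
    define h where "h = t - s"
    have h: "0 < h" "h < d1" "t = s + h" using less s by (auto simp: h_def)
    have eq: "T s x - T t x - (s - t) *\<^sub>R T t g = - T s (T h x - x - h *\<^sub>R g) - h *\<^sub>R (T s g - T t g)"
    proof -
      have "T t x = T s (T h x)" using h s(1) by (simp add: T_add)
      moreover have "s - t = - h" using h by simp
      ultimately show ?thesis
        using s(1) by (simp add: linear_diff[OF T_linear] linear_scale[OF T_linear] scaleR_diff_right)
    qed
    have "norm (T s (T h x - x - h *\<^sub>R g)) \<le> M * (e1 * h)"
      using norm_le[OF s(1)] mult_left_mono[OF d1'[OF h(1,2)] M_ge_0] by (rule order_trans)
    also have "\<dots> \<le> e / 2 * h"
      using mult_right_mono[OF e1(2), of h] h by (simp add: mult.assoc)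
    finally have "norm (T s (T h x - x - h *\<^sub>R g)) \<le> e / 2 * h" .
    moreover have "norm (h *\<^sub>R (T s g - T t g)) \<le> e / 2 * h"
      using d2(2)[of s] s h by (simp add: dist_norm)
    ultimately have "norm (- T s (T h x - x - h *\<^sub>R g) - h *\<^sub>R (T s g - T t g)) \<le> e / 2 * h + e / 2 * h"
      by (intro norm_triangle_le_diff) simp
    then show ?thesis unfolding eq using h by simp
  qed simp
  then show "\<exists>d>0. \<forall>s\<in>{0..}. norm (s - t) < d \<longrightarrow>
      norm (T s x - T t x - (s - t) *\<^sub>R T t (gen T x)) \<le> e * norm (s - t)"
    using d1(1) d2(1) unfolding g_def by (intro exI[of _ "min d1 d2"]) auto
qed

end

locale stable_C0_semigroup =
  fixes T :: "real \<Rightarrow> 'a::{real_inner, complete_space} \<Rightarrow> 'a" and K \<omega> :: real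
  assumes C0': "C0_semigroup T"
    and norm_exp: "t \<ge> 0 \<Longrightarrow> norm (T t x) \<le> K * exp (- \<omega> * t) * norm x"
    and K_ge_0: "K \<ge> 0" and om: "\<omega> > 0"

sublocale stable_C0_semigroup \<subseteq> bounded_C0_semigroup T K
proof
  fix t x assume t: "(t::real) \<ge> 0"
  have "norm (T t x) \<le> K * exp (- \<omega> * t) * norm x" by (rule norm_exp[OF t])
  also have "\<dots> \<le> K * 1 * norm x"
    using K_ge_0 om t by (intro mult_right_mono mult_left_mono) auto
  finally show "norm (T t x) \<le> K * norm x" by simp
qed (use C0' K_ge_0 in auto)

context stable_C0_semigroup
begin

lemma orbit_tendsto_0: "((\<lambda>t. T t x) \<longlongrightarrow> 0) at_top"
proof (rule Lim_null_comparison)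
  show "\<forall>\<^sub>F t in at_top. norm (T t x) \<le> K * exp (- \<omega> * t) * norm x"
    using eventually_ge_at_top[of 0] by eventually_elim (rule norm_exp)
  have "filterlim (\<lambda>t. - \<omega> * t) at_bot at_top"
    using om by (intro filterlim_tendsto_neg_mult_at_bot[OF tendsto_const]) (auto simp: filterlim_ident)
  then have "((\<lambda>t. exp (- \<omega> * t)) \<longlongrightarrow> 0) at_top"
    by (rule filterlim_compose[OF exp_at_bot])
  then show "((\<lambda>t. K * exp (- \<omega> * t) * norm x) \<longlongrightarrow> 0) at_top"
    by (intro tendsto_mult_left_zero tendsto_mult_right_zero)
qed

text \<open>The orbit of a vector in the kernel is constant, while exponential stability sends it to
  0.\<close>

lemma gen_inj:
  assumes "x \<in> gen_dom T" "gen T x = 0"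
  shows "x = 0"
proof -
  have eq: "T t x = x" if "t \<ge> 0" for t
  proof -
    have "T t x = T 0 x"
    proof (rule vector_derivative_zero_const[OF that continuous_on_subset[OF orbit_continuous]])
      fix s assume "0 < s" "s < t"
      then show "((\<lambda>t. T t x) has_vector_derivative 0) (at s)"
        using orbit_derivative[OF assms(1), of s] has_vector_derivative_at_within_Ici
        by (simp add: assms(2) linear_0[OF T_linear])
    qed auto
    then show ?thesis by (simp add: T_0)
  qed
  have "\<forall>\<^sub>F t in at_top. T t x = x"
    using eventually_ge_at_top[of 0] by eventually_elim (rule eq)
  then have "((\<lambda>t. T t x) \<longlongrightarrow> x) at_top" by (rule tendsto_eventually)
  then show ?thesis using tendsto_unique[OF trivial_limit_at_top_linorder _ orbit_tendsto_0] by blast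
qed

end

lemma powr_le_exp_mult:
  fixes p w :: real
  assumes w: "w > 0"
  obtains C where "C > 0" "\<And>t. t \<ge> 1 \<Longrightarrow> t powr p \<le> C * exp (w * t)"
proof -
  \<comment> \<open>Small enough for |p| a <= w, so that ln (a t) <= a t - 1 bounds p ln t by w t
    plus a constant.\<close>
  define a where "a = w / (\<bar>p\<bar> + 1)"
  have a: "a > 0" "\<bar>p\<bar> * a \<le> w" using w by (auto simp: a_def field_simps)
  have "t powr p \<le> exp (\<bar>p\<bar> * \<bar>ln a\<bar>) * exp (w * t)" if t: "t \<ge> 1" for t
  proof -
    have "ln (a * t) \<le> a * t - 1" using t a by (intro ln_le_minus_one) simp
    then have l: "ln t \<le> a * t + \<bar>ln a\<bar>" using t a by (simp add: ln_mult)
    have "p * ln t \<le> \<bar>p\<bar> * ln t" using t by (intro mult_right_mono) auto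
    also have "\<dots> \<le> \<bar>p\<bar> * (a * t + \<bar>ln a\<bar>)" using l by (intro mult_left_mono) auto
    also have "\<dots> \<le> \<bar>p\<bar> * \<bar>ln a\<bar> + w * t"
      using mult_right_mono[OF a(2), of t] t by (simp add: algebra_simps)
    finally show ?thesis using t by (simp add: powr_def flip: exp_add)
  qed
  then show thesis using that[of "exp (\<bar>p\<bar> * \<bar>ln a\<bar>)"] by simp
qed

lemma tendsto_at_top_if_exp_increments:
  fixes F :: "real \<Rightarrow> 'a::{real_normed_vector, complete_space}"
  assumes w: "w > 0" and F: "\<And>a b. 1 \<le> a \<Longrightarrow> a < b \<Longrightarrow> norm (F b - F a) \<le> c * exp (- w * a)"
  obtains I where "(F \<longlongrightarrow> I) at_top"
proof -
  have "filterlim (\<lambda>t. - w * t) at_bot at_top"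
    using w by (intro filterlim_tendsto_neg_mult_at_bot[OF tendsto_const]) (auto simp: filterlim_ident)
  then have "((\<lambda>t. exp (- w * t)) \<longlongrightarrow> 0) at_top"
    by (rule filterlim_compose[OF exp_at_bot])
  then have lim0: "((\<lambda>t. c * exp (- w * t)) \<longlongrightarrow> 0) at_top" by (rule tendsto_mult_right_zero)
  have Fle: "dist (F a) (F b) \<le> c * exp (- w * a)" if "1 \<le> a" "a \<le> b" for a b
  proof (cases "a = b")
    case True
    \<comment> \<open>The sign of c is read off from the increment over [a, a + 1].\<close>
    have "0 \<le> c * exp (- w * a)" using order_trans[OF norm_ge_zero F[of a "a + 1"]] that by simp
    then show ?thesis using True by simp
  qed (use F[of a b] that in \<open>simp add: dist_norm norm_minus_commute\<close>)
  have seq: "(\<lambda>n. c * exp (- w * real n)) \<longlonglongrightarrow> 0"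
    by (rule filterlim_compose[OF lim0 filterlim_real_sequentially])
  \<comment> \<open>Completeness concerns sequences, so the limit is found along the integers and
    then compared with F t for real t.\<close>
  have "Cauchy (\<lambda>n. F (real n))"
  proof (rule metric_CauchyI)
    fix e :: real assume "e > 0"
    then have "\<forall>\<^sub>F n in sequentially. dist (c * exp (- w * real n)) 0 < e / 2"
      by (intro tendstoD[OF seq]) simp
    then obtain N where N: "\<And>n. n \<ge> N \<Longrightarrow> \<bar>c * exp (- w * real n)\<bar> < e / 2"
      unfolding eventually_sequentially dist_real_def by auto
    have "dist (F (real m)) (F (real n)) < e" if "m \<ge> N + 1" "n \<ge> N + 1" for m n
    proof -
      have "dist (F (real (N+1))) (F (real m)) < e / 2" "dist (F (real (N+1))) (F (real n)) < e / 2"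
        using Fle[of "real (N+1)" "real m"] Fle[of "real (N+1)" "real n"] N[of "N + 1"] that
        by linarith+
      then show ?thesis by (rule dist_triangle_half_r)
    qed
    then show "\<exists>N. \<forall>m\<ge>N. \<forall>n\<ge>N. dist (F (real m)) (F (real n)) < e" by blast
  qed
  then obtain I where I: "(\<lambda>n. F (real n)) \<longlonglongrightarrow> I"
    using Cauchy_convergent convergent_def by blast
  have le: "dist (F t) I \<le> c * exp (- w * t)" if t: "1 \<le> t" for t
  proof (rule tendsto_upperbound)
    show "(\<lambda>n. dist (F t) (F (real n))) \<longlonglongrightarrow> dist (F t) I" by (intro tendsto_intros I)
    have "\<forall>\<^sub>F n in sequentially. t \<le> real n"
      using filterlim_real_sequentially by (simp add: filterlim_at_top)
    then show "\<forall>\<^sub>F n in sequentially. dist (F t) (F (real n)) \<le> c * exp (- w * t)"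
      by eventually_elim (rule Fle[OF t])
  qed simp
  have "((\<lambda>t. F t - I) \<longlongrightarrow> 0) at_top"
  proof (rule Lim_null_comparison[OF _ lim0])
    show "\<forall>\<^sub>F t in at_top. norm (F t - I) \<le> c * exp (- w * t)"
      using eventually_ge_at_top[of 1] by eventually_elim (use le in \<open>simp add: dist_norm\<close>)
  qed
  then show thesis using that by (simp add: LIM_zero_iff)
qed

context stable_C0_semigroup
begin

text \<open>The substitution \<open>u = t\<^sup>\<alpha>\<close> removes the singularity of \<open>t\<^sup>\<alpha>\<^sup>-\<^sup>1\<close> at the origin.\<close>

lemma frac_antiderivative:
  assumes al: "\<alpha> > 0"
  obtains F where "F 0 = 0" "continuous_on {0..} F"
    "\<And>t. t > 0 \<Longrightarrow> (F has_vector_derivative t powr (\<alpha> - 1) *\<^sub>R T t y) (at t)"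
proof -
  have "continuous_on {0..} (\<lambda>u::real. u powr (1 / \<alpha>))"
    using al by (intro continuous_on_powr' continuous_intros) auto
  then have "continuous_on {0..} (\<lambda>u. (1 / \<alpha>) *\<^sub>R T (u powr (1 / \<alpha>)) y)"
    by (intro continuous_on_scaleR continuous_on_const continuous_on_compose2[OF orbit_continuous]) auto
  then obtain G where G: "G 0 = 0"
    "\<And>u. u \<ge> 0 \<Longrightarrow> (G has_vector_derivative (1 / \<alpha>) *\<^sub>R T (u powr (1 / \<alpha>)) y) (at u within {0..})"
    using hilbert_antiderivative by blast
  define F where "F t = G (t powr \<alpha>)" for t
  have cG: "continuous_on {0..} G"
    unfolding continuous_on_eq_continuous_within
    using G(2) has_vector_derivative_continuous by (metis atLeast_iff)
  have "continuous_on {0..} (\<lambda>t::real. t powr \<alpha>)"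
    using al by (intro continuous_on_powr' continuous_intros) auto
  then have "continuous_on {0..} F" unfolding F_def
    by (intro continuous_on_compose2[OF cG]) auto
  moreover have "(F has_vector_derivative t powr (\<alpha> - 1) *\<^sub>R T t y) (at t)" if t: "t > 0" for t
  proof -
    have "((\<lambda>t. t powr \<alpha>) has_vector_derivative \<alpha> * t powr (\<alpha> - 1)) (at t)"
      using t by (intro has_real_derivative_iff_has_vector_derivative[THEN iffD1] has_real_derivative_powr)
    moreover have "(G has_vector_derivative (1 / \<alpha>) *\<^sub>R T ((t powr \<alpha>) powr (1 / \<alpha>)) y) (at (t powr \<alpha>))"
      using t by (intro has_vector_derivative_at_within_Ici G(2)) auto
    ultimately have "((G \<circ> (\<lambda>t. t powr \<alpha>)) has_vector_derivative
        (\<alpha> * t powr (\<alpha> - 1)) *\<^sub>R (1 / \<alpha>) *\<^sub>R T ((t powr \<alpha>) powr (1 / \<alpha>)) y) (at t)"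
      by (rule vector_diff_chain_at)
    then show ?thesis using al t by (simp add: o_def F_def[abs_def] powr_powr)
  qed
  ultimately show thesis using that[of F] G(1) by (simp add: F_def)
qed

lemma frac_integral:
  assumes al: "\<alpha> > 0"
  obtains F I where "F 0 = 0" "continuous_on {0..} F"
    "\<And>t. t > 0 \<Longrightarrow> (F has_vector_derivative t powr (\<alpha> - 1) *\<^sub>R T t y) (at t)"
    "(F \<longlongrightarrow> I) at_top" "((\<lambda>t. t powr (\<alpha> - 1) *\<^sub>R T t y) has_integral I) {0..}"
proof -
  obtain F where F: "F 0 = 0" "continuous_on {0..} F"
    "\<And>t. t > 0 \<Longrightarrow> (F has_vector_derivative t powr (\<alpha> - 1) *\<^sub>R T t y) (at t)"
    using frac_antiderivative[OF al] by blast
  \<comment> \<open>Half of the decay rate absorbs the power of t; the other half makes the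
    increments of F summable.\<close>
  obtain C where C: "C > 0" "\<And>t. t \<ge> 1 \<Longrightarrow> t powr (\<alpha> - 1) \<le> C * exp (\<omega> / 2 * t)"
    using powr_le_exp_mult[of "\<omega> / 2" "\<alpha> - 1"] om by auto
  define D where "D = C * K * norm y"
  have D: "D \<ge> 0" using C K_ge_0 by (simp add: D_def)
  have "norm (F b - F a) \<le> (2 * D / \<omega>) * exp (- (\<omega> / 2) * a)" if ab: "1 \<le> a" "a < b" for a b
  proof -
    define \<phi> where "\<phi> t = - (2 * D / \<omega>) * exp (- (\<omega> / 2) * t)" for t
    have "norm (F b - F a) \<le> \<phi> b - \<phi> a"
    proof (rule differentiable_bound_general[OF ab(2)])
      show "continuous_on {a..b} F" using ab by (intro continuous_on_subset[OF F(2)]) auto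
      show "continuous_on {a..b} \<phi>" unfolding \<phi>_def by (intro continuous_intros)
      fix t assume t: "a < t" "t < b"
      show "(F has_vector_derivative t powr (\<alpha> - 1) *\<^sub>R T t y) (at t)" using F(3) t ab by simp
      show "(\<phi> has_vector_derivative D * exp (- (\<omega> / 2) * t)) (at t)"
        unfolding \<phi>_def has_real_derivative_iff_has_vector_derivative[symmetric]
        using om by (auto intro!: derivative_eq_intros)
      have "norm (t powr (\<alpha> - 1) *\<^sub>R T t y) \<le> (C * exp (\<omega> / 2 * t)) * (K * exp (- \<omega> * t) * norm y)"
        using C(2)[of t] norm_exp[of t y] t ab C(1) by (simp, intro mult_mono) auto
      also have "\<dots> = D * (exp (\<omega> / 2 * t) * exp (- \<omega> * t))" by (simp add: D_def)
      also have "exp (\<omega> / 2 * t) * exp (- \<omega> * t) = exp (- (\<omega> / 2) * t)"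
        by (simp add: field_simps flip: exp_add)
      finally show "norm (t powr (\<alpha> - 1) *\<^sub>R T t y) \<le> D * exp (- (\<omega> / 2) * t)" .
    qed
    moreover have "\<phi> b \<le> 0" unfolding \<phi>_def using D om by simp
    ultimately show ?thesis by (simp add: \<phi>_def)
  qed
  then obtain I where I: "(F \<longlongrightarrow> I) at_top"
    using tendsto_at_top_if_exp_increments[of "\<omega> / 2" F] om by (metis half_gt_zero)
  show thesis
    by (rule that[OF F I hilbert_has_integral_Ici_if_tendsto[OF F(2,1,3) I]])
qed

text \<open>The preimage is -I with I = int_0^inf T(t) y dt, taken from \<open>frac_integral\<close>
  at exponent 1. Shifting the integral gives T(h) I - I = -F(h), where F is the antiderivative of
  the orbit, and F(h)/h tends to y.\<close>

lemma gen_surj: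
  obtains x where "x \<in> gen_dom T" "gen T x = y"
proof -
  obtain F I where F: "F 0 = 0" "continuous_on {0..} F"
    "\<And>t. t > 0 \<Longrightarrow> (F has_vector_derivative t powr (1 - 1) *\<^sub>R T t y) (at t)"
    "(F \<longlongrightarrow> I) at_top"
    using frac_integral[of 1 y] by (metis zero_less_one)
  have D: "(F has_vector_derivative T t y) (at t)" if "t > 0" for t
    using F(3)[OF that] that by simp
  have shift: "T h (F t) = F (t + h) - F h" if h: "h \<ge> 0" and t: "t \<ge> 0" for h t
  proof -
    have "T h (F t) - F (t + h) = T h (F 0) - F (0 + h)"
    proof (rule vector_derivative_zero_const[OF t])
      have "continuous_on {0..t} (\<lambda>s. T h (F s))"
        by (intro bounded_linear.continuous_on[OF bl[OF h]] continuous_on_subset[OF F(2)]) auto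
      moreover have "continuous_on {0..t} (\<lambda>s. F (s + h))"
        using h by (intro continuous_on_compose2[OF F(2)] continuous_intros) auto
      ultimately show "continuous_on {0..t} (\<lambda>s. T h (F s) - F (s + h))" by (intro continuous_intros)
      fix s assume s: "0 < s" "s < t"
      have 1: "((\<lambda>s. T h (F s)) has_vector_derivative T h (T s y)) (at s)"
        by (intro bounded_linear.has_vector_derivative[OF bl[OF h]] D s)
      have "((F \<circ> (\<lambda>s. s + h)) has_vector_derivative 1 *\<^sub>R T (s + h) y) (at s)"
        using s h by (intro vector_diff_chain_at D) (auto intro!: derivative_eq_intros)
      then have 2: "((\<lambda>s. F (s + h)) has_vector_derivative T h (T s y)) (at s)"
        using s h T_add[of h s y] by (simp add: o_def add.commute)
      show "((\<lambda>s. T h (F s) - F (s + h)) has_vector_derivative 0) (at s)"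
        using has_vector_derivative_diff[OF 1 2] by simp
    qed
    then show ?thesis using linear_0[OF T_linear[OF h]] F(1) by (simp add: algebra_simps)
  qed
  have TI: "T h I - I = - F h" if h: "h \<ge> 0" for h
  proof -
    have "((\<lambda>t. T h (F t)) \<longlongrightarrow> T h I) at_top" by (rule bounded_linear.tendsto[OF bl[OF h] F(4)])
    moreover have "((\<lambda>t. F (t + h) - F h) \<longlongrightarrow> I - F h) at_top"
      by (intro tendsto_intros filterlim_compose[OF F(4)] filterlim_tendsto_add_at_top[of "\<lambda>_. h", unfolded add.commute[of h]])
        (auto simp: filterlim_ident add.commute intro: filterlim_at_top_add_at_top)
    moreover have "\<forall>\<^sub>F t in at_top. T h (F t) = F (t + h) - F h"
      using eventually_ge_at_top[of 0] by eventually_elim (rule shift[OF h])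
    ultimately have "T h I = I - F h"
      using tendsto_unique[OF trivial_limit_at_top_linorder] tendsto_cong by fast
    then show ?thesis by simp
  qed
  have "((\<lambda>h. (F h) /\<^sub>R h) \<longlongrightarrow> y) (at_right 0)"
    unfolding tendsto_iff
  proof (intro allI impI)
    fix e :: real assume e: "e > 0"
    have "eventually (\<lambda>h. dist (T h y) y < e / 2) (at_right 0)"
      using e by (intro tendstoD[OF T_right]) auto
    then obtain d where d: "d > 0" "\<And>h. 0 < h \<Longrightarrow> h < d \<Longrightarrow> dist (T h y) y < e / 2"
      unfolding eventually_at_right_field by blast
    have "dist ((F h) /\<^sub>R h) y < e" if h: "0 < h" "h < d" for h
    proof -
      have "norm ((F h - h *\<^sub>R y) - (F 0 - 0 *\<^sub>R y)) \<le> e / 2 * h - e / 2 * 0"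
      proof (rule differentiable_bound_general[OF h(1)])
        show "continuous_on {0..h} (\<lambda>h. F h - h *\<^sub>R y)"
          using h by (intro continuous_intros continuous_on_subset[OF F(2)]) auto
        show "continuous_on {0..h} (\<lambda>h. e / 2 * h)" by (intro continuous_intros)
        fix t assume t: "0 < t" "t < h"
        show "((\<lambda>h. F h - h *\<^sub>R y) has_vector_derivative T t y - y) (at t)"
          using t by (auto intro!: derivative_eq_intros D)
        show "((*) (e / 2) has_vector_derivative e / 2) (at t)"
          by (auto intro!: derivative_eq_intros)
        show "norm (T t y - y) \<le> e / 2" using d(2)[of t] t h by (simp add: dist_norm)
      qed
      then have le: "norm (F h - h *\<^sub>R y) \<le> e / 2 * h" by (simp add: F(1))
      have "F h - h *\<^sub>R y = h *\<^sub>R ((F h) /\<^sub>R h - y)" using h by (simp add: scaleR_diff_right)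
      then have "norm (F h - h *\<^sub>R y) = h * norm ((F h) /\<^sub>R h - y)" using h by (metis abs_of_pos norm_scaleR)
      then have "h * norm ((F h) /\<^sub>R h - y) \<le> h * (e / 2)" using le by (simp add: mult.commute)
      then have "norm ((F h) /\<^sub>R h - y) \<le> e / 2" using h(1) by (rule mult_left_le_imp_le)
      then show ?thesis using e by (simp add: dist_norm)
    qed
    then show "\<forall>\<^sub>F h in at_right 0. dist ((F h) /\<^sub>R h) y < e"
      unfolding eventually_at_right_field using d(1) by blast
  qed
  moreover have "\<forall>\<^sub>F h in at_right 0. (F h) /\<^sub>R h = (T h (- I) - (- I)) /\<^sub>R h"
    using eventually_at_right_less[of "0::real"]
  proof eventually_elim
    case (elim h)
    then have "T h (- I) - (- I) = - (T h I - I)" by (simp add: linear_neg[OF T_linear])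
    then show ?case using TI[of h] elim by simp
  qed
  ultimately have "((\<lambda>h. (T h (- I) - (- I)) /\<^sub>R h) \<longlongrightarrow> y) (at_right 0)"
    using tendsto_cong by fast
  then show thesis using gen_eqI that by blast
qed

end

text \<open>A truncated weighted Gramian. The finite horizon L keeps the integrand continuous on a
  compact interval; the end term at L that this causes is made small by the choice of L.\<close>

definition orbit_form :: "(real \<Rightarrow> 'a::real_inner \<Rightarrow> 'a) \<Rightarrow> (real \<Rightarrow> real) \<Rightarrow> real \<Rightarrow> 'a \<Rightarrow> 'a \<Rightarrow> real" where
  "orbit_form X g L x y = integral {0..L} (\<lambda>t. g t * inner (X t x) (X t y))"

lemma orbit_form_integrable:
  fixes X :: "real \<Rightarrow> 'a::real_inner \<Rightarrow> 'a"
  assumes "\<And>x. continuous_on {0..} (\<lambda>t. X t x)" "continuous_on {0..} g"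
  shows "(\<lambda>t. g t * inner (X t x) (X t y)) integrable_on {0..L}"
proof (rule integrable_continuous_real)
  have "continuous_on {0..} (\<lambda>t. g t * inner (X t x) (X t y))"
    using assms by (intro continuous_intros)
  then show "continuous_on {0..L} (\<lambda>t. g t * inner (X t x) (X t y))"
    by (rule continuous_on_subset) auto
qed

text \<open>The parameter s may be negative: subtracting the cases s and -s isolates the mixed form,
  which is how one Cayley step is measured.\<close>

lemma orbit_form_quadratic:
  assumes X: "\<And>x. continuous_on {0..} (\<lambda>t. X t x)" and g: "continuous_on {0..} g"
    and lin: "\<And>t. t \<ge> 0 \<Longrightarrow> linear (X t)"
  shows "orbit_form X g L (x + s *\<^sub>R y) (x + s *\<^sub>R y)
    = orbit_form X g L x x + s\<^sup>2 * orbit_form X g L y y + 2 * s * orbit_form X g L x y"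
proof -
  note int = integrable_integral[OF orbit_form_integrable[OF X g], folded orbit_form_def]
  have "((\<lambda>t. g t * inner (X t x) (X t x) + s\<^sup>2 * (g t * inner (X t y) (X t y))
      + 2 * s * (g t * inner (X t x) (X t y)))
    has_integral orbit_form X g L x x + s\<^sup>2 * orbit_form X g L y y + 2 * s * orbit_form X g L x y) {0..L}"
    by (intro has_integral_add has_integral_mult_right int)
  then have "((\<lambda>t. g t * inner (X t (x + s *\<^sub>R y)) (X t (x + s *\<^sub>R y)))
    has_integral orbit_form X g L x x + s\<^sup>2 * orbit_form X g L y y + 2 * s * orbit_form X g L x y) {0..L}"
    by (rule has_integral_eq[rotated])
      (simp add: linear_add[OF lin] linear_scale[OF lin] inner_add inner_commute power2_eq_square algebra_simps)
  then show ?thesis unfolding orbit_form_def by (rule integral_unique)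
qed

section \<open>Lyapunov estimates along a trajectory\<close>

text \<open>\<open>B\<close> plays the role of \<open>A\<^sup>-\<^sup>1\<close>, so that unbounded operators do not occur.\<close>

locale cayley_pair =
  fixes T S :: "real \<Rightarrow> 'a::{real_inner, complete_space} \<Rightarrow> 'a" and B :: "'a \<Rightarrow> 'a"
    and K \<omega> M b :: real
  assumes T_lin: "t \<ge> 0 \<Longrightarrow> linear (T t)" and S_lin: "t \<ge> 0 \<Longrightarrow> linear (S t)" and B_lin: "linear B"
    and T_id: "T 0 x = x" and S_id: "S 0 x = x"
    and T_le: "t \<ge> 0 \<Longrightarrow> norm (T t x) \<le> K * exp (- \<omega> * t) * norm x"
    and S_le: "t \<ge> 0 \<Longrightarrow> norm (S t x) \<le> M * norm x" and B_le: "norm (B x) \<le> b * norm x"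
    and pos: "K > 0" "\<omega> > 0" "M > 0" "b > 0"
    and T_cont: "continuous_on {0..} (\<lambda>t. T t x)" and S_cont: "continuous_on {0..} (\<lambda>t. S t x)"
    and T_deriv: "t \<ge> 0 \<Longrightarrow> ((\<lambda>t. T t (B x)) has_vector_derivative T t x) (at t within {0..})"
    and S_deriv: "t \<ge> 0 \<Longrightarrow> ((\<lambda>t. S t x) has_vector_derivative S t (B x)) (at t within {0..})"
begin

lemma T_le': "t \<ge> 0 \<Longrightarrow> norm (T t x) \<le> K * norm x"
proof -
  assume t: "t \<ge> 0"
  have "K * exp (- \<omega> * t) * norm x \<le> K * 1 * norm x"
    using pos t by (intro mult_right_mono mult_left_mono) auto
  then show ?thesis using T_le[OF t, of x] by simp
qed

text \<open>By polarisation the left-hand difference is 4 s times the form at (B w, w). Since T(t) w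
  is the derivative of T(t) B w, twice that form equals |T(L) B w|^2 - |B w|^2, whatever s
  is.\<close>

lemma lyapunov_T:
  obtains V C where "C > 0" "\<And>x. 0 \<le> V x" "\<And>x. V x \<le> C * (norm x)\<^sup>2"
    "\<And>w s. s > 0 \<Longrightarrow> V (B w + s *\<^sub>R w) - V (B w - s *\<^sub>R w) \<le> - s * (norm (B w))\<^sup>2"
proof -
  \<comment> \<open>Large enough that (K e^(-\<omega> L))^2 <= 1/2, so the end term costs at most
    half of |B w|^2; the absolute value and the 1 ensure L > 0.\<close>
  define L where "L = (\<bar>ln (2 * K\<^sup>2)\<bar> + 1) / (2 * \<omega>)"
  have L: "L > 0" using pos by (simp add: L_def)
  have "ln (2 * K\<^sup>2) \<le> 2 * \<omega> * L" using pos by (simp add: L_def)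
  then have "exp (ln (2 * K\<^sup>2)) \<le> exp (2 * \<omega> * L)" by (subst exp_le_cancel_iff)
  then have "2 * K\<^sup>2 \<le> exp (2 * \<omega> * L)" using pos by simp
  then have KL: "(K * exp (- \<omega> * L))\<^sup>2 \<le> 1 / 2"
    by (simp add: power_mult_distrib exp_minus field_simps flip: exp_of_nat_mult exp_add)
  define V where "V x = orbit_form T (\<lambda>_. 1) L x x" for x
  note quad = orbit_form_quadratic[OF T_cont continuous_on_const[of _ 1] T_lin]
  have "V (B w + s *\<^sub>R w) - V (B w - s *\<^sub>R w) \<le> - s * (norm (B w))\<^sup>2" if s: "s > 0" for w s
  proof -
    have "((\<lambda>t. inner (T t (B w)) (T t w) + inner (T t w) (T t (B w))) has_integral
        inner (T L (B w)) (T L (B w)) - inner (T 0 (B w)) (T 0 (B w))) {0..L}"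
    proof (rule fundamental_theorem_of_calculus)
      fix t assume "t \<in> {0..L}"
      then have "((\<lambda>t. T t (B w)) has_vector_derivative T t w) (at t within {0..L})"
        using has_vector_derivative_within_subset[OF T_deriv] by auto
      then show "((\<lambda>t. inner (T t (B w)) (T t (B w))) has_vector_derivative
          inner (T t (B w)) (T t w) + inner (T t w) (T t (B w))) (at t within {0..L})"
        by (intro bounded_bilinear.has_vector_derivative[OF bounded_bilinear_inner])
    qed (use L in simp)
    then have "2 * orbit_form T (\<lambda>_. 1) L (B w) w = (norm (T L (B w)))\<^sup>2 - (norm (B w))\<^sup>2"
      by (simp add: orbit_form_def inner_commute T_id power2_norm_eq_inner integral_unique
          flip: integral_mult_right)
    moreover have "(norm (T L (B w)))\<^sup>2 \<le> (K * exp (- \<omega> * L) * norm (B w))\<^sup>2"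
      using T_le[of L "B w"] L by (intro power_mono) auto
    moreover have "\<dots> \<le> 1 / 2 * (norm (B w))\<^sup>2"
      using KL by (simp only: power_mult_distrib[of _ "norm (B w)"]) (intro mult_right_mono, auto)
    ultimately have "2 * orbit_form T (\<lambda>_. 1) L (B w) w \<le> - (norm (B w))\<^sup>2 / 2" by linarith
    then have "2 * s * (2 * orbit_form T (\<lambda>_. 1) L (B w) w) \<le> 2 * s * (- (norm (B w))\<^sup>2 / 2)"
      using s by (intro mult_left_mono) auto
    then show ?thesis
      using quad[of L "B w" s w] quad[of L "B w" "- s" w] by (simp add: V_def)
  qed
  moreover have "0 \<le> V x" for x
    unfolding V_def orbit_form_def
    using orbit_form_integrable[OF T_cont continuous_on_const[of _ 1]]
    by (intro integral_nonneg) auto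
  moreover have "V x \<le> L * K\<^sup>2 * (norm x)\<^sup>2" for x
  proof -
    have "V x \<le> integral {0..L} (\<lambda>t. K\<^sup>2 * (norm x)\<^sup>2)"
      unfolding V_def orbit_form_def
    proof (rule integral_le)
      show "(\<lambda>t. 1 * inner (T t x) (T t x)) integrable_on {0..L}"
        by (rule orbit_form_integrable[OF T_cont continuous_on_const])
      fix t assume "t \<in> {0..L}"
      then have "(norm (T t x))\<^sup>2 \<le> (K * norm x)\<^sup>2" by (intro power_mono T_le') auto
      then show "1 * inner (T t x) (T t x) \<le> K\<^sup>2 * (norm x)\<^sup>2"
        by (simp add: power2_norm_eq_inner power_mult_distrib)
    qed auto
    then show ?thesis using L by (simp add: mult_ac)
  qed
  ultimately show thesis using that[of "L * K\<^sup>2" V] L pos by simp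
qed

text \<open>The exponential weight pays for the missing decay of \<open>S\<close>; its rate \<open>r\<close> will be coupled to the
  number of time steps.\<close>

lemma lyapunov_S:
  assumes r: "r > 0"
  obtains Q q where "\<And>x. 0 \<le> Q x" "\<And>x. Q x \<le> M\<^sup>2 / (2 * r) * (norm x)\<^sup>2"
    "\<And>w. 2 * q w \<le> 2 * r * Q w - (norm w)\<^sup>2 / 2"
    "\<And>w s. Q (B w + s *\<^sub>R w) = Q (B w) + s\<^sup>2 * Q w + 2 * s * q w"
proof -
  \<comment> \<open>Here the weight alone must reduce the end term, hence e^(-2 r L) M^2 <=
    1/2.\<close>
  define L where "L = (\<bar>ln (2 * M\<^sup>2)\<bar> + 1) / (2 * r)"
  have L: "L > 0" using r by (simp add: L_def)
  have "ln (2 * M\<^sup>2) \<le> 2 * r * L" using r by (simp add: L_def)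
  then have "exp (ln (2 * M\<^sup>2)) \<le> exp (2 * r * L)" by (subst exp_le_cancel_iff)
  then have "2 * M\<^sup>2 \<le> exp (2 * r * L)" using pos by simp
  then have M_half: "exp (- 2 * r * L) * M\<^sup>2 \<le> 1 / 2"
    by (simp add: exp_minus field_simps)
  define g where "g t = exp (- 2 * r * t)" for t
  have g: "continuous_on {0..} g" unfolding g_def by (intro continuous_intros)
  define Q where "Q x = orbit_form S g L x x" for x
  define q where "q w = orbit_form S g L (B w) w" for w
  note int = integrable_integral[OF orbit_form_integrable[OF S_cont g], folded orbit_form_def]
  have "2 * q w \<le> 2 * r * Q w - (norm w)\<^sup>2 / 2" for w
  proof -
    have "((\<lambda>t. g t * (inner (S t w) (S t (B w)) + inner (S t (B w)) (S t w))
        + (- 2 * r * g t) * inner (S t w) (S t w)) has_integral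
        g L * inner (S L w) (S L w) - g 0 * inner (S 0 w) (S 0 w)) {0..L}"
    proof (rule fundamental_theorem_of_calculus)
      fix t assume t: "t \<in> {0..L}"
      then have "((\<lambda>t. S t w) has_vector_derivative S t (B w)) (at t within {0..L})"
        using has_vector_derivative_within_subset[OF S_deriv] by auto
      then have "((\<lambda>t. inner (S t w) (S t w)) has_vector_derivative
          inner (S t w) (S t (B w)) + inner (S t (B w)) (S t w)) (at t within {0..L})"
        by (intro bounded_bilinear.has_vector_derivative[OF bounded_bilinear_inner])
      moreover have "(g has_vector_derivative - 2 * r * g t) (at t within {0..L})"
        unfolding g_def has_real_derivative_iff_has_vector_derivative[symmetric]
        by (auto intro!: derivative_eq_intros)
      ultimately show "((\<lambda>t. g t * inner (S t w) (S t w)) has_vector_derivative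
          g t * (inner (S t w) (S t (B w)) + inner (S t (B w)) (S t w))
            + (- 2 * r * g t) * inner (S t w) (S t w)) (at t within {0..L})"
        by (intro has_vector_derivative_mult)
    qed (use L in simp)
    moreover have "((\<lambda>t. 2 * (g t * inner (S t (B w)) (S t w)) + (- 2 * r) * (g t * inner (S t w) (S t w)))
        has_integral 2 * q w + (- 2 * r) * Q w) {0..L}"
      unfolding q_def Q_def by (intro has_integral_add has_integral_mult_right int)
    then have "((\<lambda>t. g t * (inner (S t w) (S t (B w)) + inner (S t (B w)) (S t w))
        + (- 2 * r * g t) * inner (S t w) (S t w)) has_integral 2 * q w + (- 2 * r) * Q w) {0..L}"
      by (rule has_integral_eq[rotated]) (simp add: inner_commute algebra_simps)
    ultimately have "2 * q w + (- 2 * r) * Q w = g L * inner (S L w) (S L w) - g 0 * inner (S 0 w) (S 0 w)"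
      by (rule has_integral_unique[symmetric])
    \<comment> \<open>The term 2 r Q w comes from differentiating the weight. It has the wrong sign
      and stays in the estimate; \<open>sum_sq_w_le\<close> compensates it.\<close>
    then have eq: "2 * q w = 2 * r * Q w + g L * (norm (S L w))\<^sup>2 - (norm w)\<^sup>2"
      by (simp add: g_def S_id power2_norm_eq_inner)
    have "g L * (norm (S L w))\<^sup>2 \<le> g L * (M * norm w)\<^sup>2"
      using L by (intro mult_left_mono power_mono S_le) (auto simp: g_def)
    also have "\<dots> = (g L * M\<^sup>2) * (norm w)\<^sup>2" by (simp add: power_mult_distrib)
    also have "\<dots> \<le> 1 / 2 * (norm w)\<^sup>2" using M_half by (intro mult_right_mono) (auto simp: g_def)
    finally show ?thesis using eq by linarith
  qed
  moreover have "0 \<le> Q x" for x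
    unfolding Q_def orbit_form_def
    using orbit_form_integrable[OF S_cont g] by (intro integral_nonneg) (auto simp: g_def)
  moreover have "Q x \<le> M\<^sup>2 / (2 * r) * (norm x)\<^sup>2" for x
  proof -
    have "((\<lambda>t. g t) has_integral - g L / (2 * r) - - g 0 / (2 * r)) {0..L}"
    proof (rule fundamental_theorem_of_calculus)
      fix t assume "t \<in> {0..L}"
      show "((\<lambda>t. - g t / (2 * r)) has_vector_derivative g t) (at t within {0..L})"
        unfolding g_def has_real_derivative_iff_has_vector_derivative[symmetric]
        using r by (auto intro!: derivative_eq_intros)
    qed (use L in simp)
    then have gi: "((\<lambda>t. g t * (M\<^sup>2 * (norm x)\<^sup>2)) has_integral
        (- g L / (2 * r) - - g 0 / (2 * r)) * (M\<^sup>2 * (norm x)\<^sup>2)) {0..L}"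
      by (rule has_integral_mult_left)
    have "Q x \<le> (- g L / (2 * r) - - g 0 / (2 * r)) * (M\<^sup>2 * (norm x)\<^sup>2)"
      unfolding Q_def
    proof (rule has_integral_le[OF int gi])
      fix t assume "t \<in> {0..L}"
      then have "(norm (S t x))\<^sup>2 \<le> (M * norm x)\<^sup>2" by (intro power_mono S_le) auto
      then show "g t * inner (S t x) (S t x) \<le> g t * (M\<^sup>2 * (norm x)\<^sup>2)"
        by (simp add: power2_norm_eq_inner power_mult_distrib g_def)
    qed
    also have "\<dots> \<le> 1 / (2 * r) * (M\<^sup>2 * (norm x)\<^sup>2)"
      using r by (intro mult_right_mono) (auto simp: g_def)
    finally show ?thesis by simp
  qed
  moreover have "Q (B w + s *\<^sub>R w) = Q (B w) + s\<^sup>2 * Q w + 2 * s * q w" for w s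
    unfolding Q_def q_def by (rule orbit_form_quadratic[OF S_cont g S_lin])
  ultimately show thesis using that[of Q q] by blast
qed

text \<open>With \<open>s\<^sub>k = \<tau>\<^sub>k / 2\<close> and \<open>w\<^sub>k = A (I - s\<^sub>k A)\<^sup>-\<^sup>1 x\<^sub>k\<close> this is the Crank--Nicolson recursion.\<close>

definition cayley_orbit :: "(nat \<Rightarrow> real) \<Rightarrow> (nat \<Rightarrow> 'a) \<Rightarrow> (nat \<Rightarrow> 'a) \<Rightarrow> bool" where
  "cayley_orbit s w x \<longleftrightarrow>
    (\<forall>k. x k = B (w k) - s k *\<^sub>R w k \<and> x (Suc k) = B (w k) + s k *\<^sub>R w k)"

lemma cayley_orbitD:
  assumes "cayley_orbit s w x"
  shows "x k = B (w k) - s k *\<^sub>R w k" "x (Suc k) = B (w k) + s k *\<^sub>R w k"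
  using assms unfolding cayley_orbit_def by blast+

text \<open>The decrease of V telescopes along the trajectory and V >= 0 closes the sum, so the
  bound is uniform in N and in the step sequence.\<close>

lemma sum_sq_B_le:
  assumes c: "c > 0"
  obtains C where "C > 0" "\<And>s w x N. \<forall>k. c \<le> s k \<Longrightarrow> cayley_orbit s w x \<Longrightarrow>
    (\<Sum>k<N. (norm (B (w k)))\<^sup>2) \<le> C * (norm (x 0))\<^sup>2"
proof -
  obtain V C where V: "C > 0" "\<And>x. 0 \<le> V x" "\<And>x. V x \<le> C * (norm x)\<^sup>2"
    "\<And>w s. s > 0 \<Longrightarrow> V (B w + s *\<^sub>R w) - V (B w - s *\<^sub>R w) \<le> - s * (norm (B w))\<^sup>2"
    by (rule lyapunov_T) (rule that; assumption)
  have main: "(\<Sum>k<N. (norm (B (w k)))\<^sup>2) \<le> C / c * (norm (x 0))\<^sup>2"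
    if s': "\<forall>k. c \<le> s k" and x: "cayley_orbit s w x" for s w x N
  proof -
    have s: "c \<le> s k" for k using s' by blast
    have "c * (\<Sum>k<N. (norm (B (w k)))\<^sup>2) \<le> (\<Sum>k<N. V (x k) - V (x (Suc k)))"
      unfolding sum_distrib_left
    proof (rule sum_mono)
      fix k
      have "c * (norm (B (w k)))\<^sup>2 \<le> s k * (norm (B (w k)))\<^sup>2" using s by (intro mult_right_mono) auto
      also have "\<dots> \<le> V (x k) - V (x (Suc k))"
        using V(4)[of "s k" "w k"] less_le_trans[OF c s[of k]] by (simp flip: cayley_orbitD[OF x])
      finally show "c * (norm (B (w k)))\<^sup>2 \<le> V (x k) - V (x (Suc k))" .
    qed
    also have "\<dots> = V (x 0) - V (x N)" by (rule sum_lessThan_telescope')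
    also have "\<dots> \<le> C * (norm (x 0))\<^sup>2" using V(2)[of "x N"] V(3)[of "x 0"] by linarith
    finally show ?thesis using c by (simp add: field_simps)
  qed
  show thesis
  proof (rule that)
    show "C / c > 0" using V(1) c by simp
  qed (rule main; assumption)
qed

text \<open>Q need not decrease, because of the defect 2 r Q w. Multiplying Q by a weight that falls
  by 1 per step releases Q(B w) + s^2 Q(w) each time, and s^2 Q(w) swallows the defect once r is of
  order c/N.\<close>

lemma sum_sq_w_le:
  assumes c: "c > 0" and s: "\<And>k. c \<le> s k" and x: "cayley_orbit s w x" and N: "N > 0"
  shows "(\<Sum>k<N. (norm (w k))\<^sup>2) \<le> 8 * M\<^sup>2 / c\<^sup>2 * real N * (norm (x 0))\<^sup>2"
proof -
  define n where "n = real N"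
  have n: "n \<ge> 1" using N by (simp add: n_def)
  \<comment> \<open>Chosen so that 4 n times 2 r equals c, where 4 n bounds the sum of two
    consecutive weights.\<close>
  define r where "r = c / (8 * n)"
  have r: "r > 0" using c n by (simp add: r_def)
  obtain Q q where Q: "\<And>x. 0 \<le> Q x" "\<And>x. Q x \<le> M\<^sup>2 / (2 * r) * (norm x)\<^sup>2"
    "\<And>w. 2 * q w \<le> 2 * r * Q w - (norm w)\<^sup>2 / 2"
    "\<And>w s. Q (B w + s *\<^sub>R w) = Q (B w) + s\<^sup>2 * Q w + 2 * s * q w"
    by (rule lyapunov_S[OF r]) (rule that; assumption)
  \<comment> \<open>Starting at 2 n instead of n keeps the weight at least n up to step N, so every
    step still yields a multiple of n |w|^2.\<close>
  define a where "a k = 2 * n - real k" for k :: nat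
  have step: "c * n * (norm (w k))\<^sup>2 \<le> a k * Q (x k) - a (Suc k) * Q (x (Suc k))" if k: "k < N" for k
  proof -
    define \<sigma> W where "\<sigma> = s k" and "W = w k"
    have \<sigma>: "\<sigma> \<ge> c" "\<sigma> > 0" using s c by (auto simp: \<sigma>_def intro: less_le_trans)
    define A where "A = a k + a (Suc k)"
    have A: "2 * n \<le> A" "A \<le> 4 * n" using k n by (auto simp: A_def a_def n_def)
    have Qx: "Q (x k) = Q (B W) + \<sigma>\<^sup>2 * Q W - 2 * \<sigma> * q W"
      "Q (x (Suc k)) = Q (B W) + \<sigma>\<^sup>2 * Q W + 2 * \<sigma> * q W"
      using Q(4)[of W \<sigma>] Q(4)[of W "- \<sigma>"]
      by (simp_all add: \<sigma>_def W_def flip: cayley_orbitD[OF x])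
    have eq: "a k * Q (x k) - a (Suc k) * Q (x (Suc k))
        = (a k - a (Suc k)) * (Q (B W) + \<sigma>\<^sup>2 * Q W) - A * \<sigma> * (2 * q W)"
      unfolding Qx by (simp add: A_def algebra_simps)
    have "A * \<sigma> * (2 * q W) \<le> A * \<sigma> * (2 * r * Q W - (norm W)\<^sup>2 / 2)"
      using A \<sigma> n by (intro mult_left_mono Q(3)) auto
    also have "\<dots> = (A * (2 * r)) * (\<sigma> * Q W) - A * (\<sigma> * (norm W)\<^sup>2 / 2)" by (simp add: algebra_simps)
    also have "\<dots> \<le> \<sigma> * (\<sigma> * Q W) - 2 * n * (\<sigma> * (norm W)\<^sup>2 / 2)"
    proof (intro diff_mono mult_right_mono A)
      have "A * (2 * r) \<le> 4 * n * (2 * r)" using A r by (intro mult_right_mono) auto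
      also have "\<dots> = c" using n by (simp add: r_def)
      finally show "A * (2 * r) \<le> \<sigma>" using \<sigma> by simp
    qed (use \<sigma> Q(1) in auto)
    finally have "A * \<sigma> * (2 * q W) \<le> \<sigma>\<^sup>2 * Q W - \<sigma> * (n * (norm W)\<^sup>2)"
      by (simp add: power2_eq_square mult_ac)
    moreover have "c * (n * (norm W)\<^sup>2) \<le> \<sigma> * (n * (norm W)\<^sup>2)"
      using \<sigma> n by (intro mult_right_mono) auto
    moreover have "(a k - a (Suc k)) * (Q (B W) + \<sigma>\<^sup>2 * Q W) = Q (B W) + \<sigma>\<^sup>2 * Q W" by (simp add: a_def)
    ultimately show ?thesis unfolding eq mult.assoc W_def[symmetric] using Q(1)[of "B W"] by linarith
  qed
  have "c * n * (\<Sum>k<N. (norm (w k))\<^sup>2) \<le> (\<Sum>k<N. a k * Q (x k) - a (Suc k) * Q (x (Suc k)))"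
    unfolding sum_distrib_left using step by (intro sum_mono) auto
  also have "\<dots> = a 0 * Q (x 0) - a N * Q (x N)" by (rule sum_lessThan_telescope')
  also have "\<dots> \<le> 2 * n * Q (x 0)" using Q(1)[of "x N"] n by (simp add: a_def n_def)
  also have "\<dots> \<le> 2 * n * (M\<^sup>2 / (2 * r) * (norm (x 0))\<^sup>2)" using n by (intro mult_left_mono Q) auto
  also have "\<dots> = c * n * (8 * M\<^sup>2 / c\<^sup>2 * n * (norm (x 0))\<^sup>2)"
    using c n by (simp add: r_def power2_eq_square field_simps)
  finally have "(\<Sum>k<N. (norm (w k))\<^sup>2) \<le> 8 * M\<^sup>2 / c\<^sup>2 * n * (norm (x 0))\<^sup>2"
    by (rule mult_left_le_imp_le) (use c n in simp)
  then show ?thesis by (simp only: n_def)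
qed

lemma sum_sq_orbit_le:
  assumes c: "c > 0"
  obtains C where "C > 0" "\<And>s w x N. \<forall>k. c \<le> s k \<and> s k \<le> d \<Longrightarrow> cayley_orbit s w x \<Longrightarrow>
    (\<Sum>k<N. (norm (x k))\<^sup>2) \<le> C * real N * (norm (x 0))\<^sup>2"
proof -
  obtain C where C: "C > 0" "\<And>s w x N. \<forall>k. c \<le> s k \<Longrightarrow> cayley_orbit s w x \<Longrightarrow>
    (\<Sum>k<N. (norm (B (w k)))\<^sup>2) \<le> C * (norm (x 0))\<^sup>2"
    by (rule sum_sq_B_le[OF c]) (rule that; assumption)
  define C' where "C' = 2 * C + 2 * d\<^sup>2 * (8 * M\<^sup>2 / c\<^sup>2)"
  have main: "(\<Sum>k<N. (norm (x k))\<^sup>2) \<le> C' * real N * (norm (x 0))\<^sup>2"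
    if s': "\<forall>k. c \<le> s k \<and> s k \<le> d" and x: "cayley_orbit s w x" for s w x N
  proof (cases "N = 0")
    case False
    have s: "c \<le> s k" "s k \<le> d" for k using s' by blast+
    have "(norm (x k))\<^sup>2 \<le> 2 * (norm (B (w k)))\<^sup>2 + 2 * d\<^sup>2 * (norm (w k))\<^sup>2" for k
    proof -
      have "norm (x k) \<le> norm (B (w k)) + d * norm (w k)"
        using c s(1)[of k] norm_triangle_ineq4[of "B (w k)" "s k *\<^sub>R w k"]
          mult_right_mono[OF s(2)[of k], of "norm (w k)"]
        by (simp flip: cayley_orbitD(1)[OF x])
      then have "(norm (x k))\<^sup>2 \<le> (norm (B (w k)) + d * norm (w k))\<^sup>2" by (intro power_mono) auto
      also have "\<dots> \<le> 2 * (norm (B (w k)))\<^sup>2 + 2 * (d * norm (w k))\<^sup>2"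
        using sum_squares_bound[of "norm (B (w k))" "d * norm (w k)"] by (simp add: power2_sum)
      finally show ?thesis by (simp add: power_mult_distrib)
    qed
    then have "(\<Sum>k<N. (norm (x k))\<^sup>2)
        \<le> (\<Sum>k<N. 2 * (norm (B (w k)))\<^sup>2 + 2 * d\<^sup>2 * (norm (w k))\<^sup>2)"
      by (intro sum_mono)
    also have "\<dots> = 2 * (\<Sum>k<N. (norm (B (w k)))\<^sup>2) + 2 * d\<^sup>2 * (\<Sum>k<N. (norm (w k))\<^sup>2)"
      by (simp add: sum.distrib sum_distrib_left)
    also have "\<dots> \<le> 2 * (C * real N * (norm (x 0))\<^sup>2) + 2 * d\<^sup>2 * (8 * M\<^sup>2 / c\<^sup>2 * real N * (norm (x 0))\<^sup>2)"
    proof (intro add_mono mult_left_mono)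
      have "C * 1 * (norm (x 0))\<^sup>2 \<le> C * real N * (norm (x 0))\<^sup>2"
        using False C(1) by (intro mult_right_mono mult_left_mono) auto
      then show "(\<Sum>k<N. (norm (B (w k)))\<^sup>2) \<le> C * real N * (norm (x 0))\<^sup>2"
        using C(2)[OF allI[OF s(1)] x, of N] by simp
      show "(\<Sum>k<N. (norm (w k))\<^sup>2) \<le> 8 * M\<^sup>2 / c\<^sup>2 * real N * (norm (x 0))\<^sup>2"
        using False by (intro sum_sq_w_le[OF c s(1) x]) auto
    qed auto
    also have "\<dots> = C' * real N * (norm (x 0))\<^sup>2" by (simp add: C'_def algebra_simps)
    finally show ?thesis .
  qed simp
  show thesis
  proof (rule that)
    show "C' > 0" using C(1) by (simp add: C'_def add_pos_nonneg)
  qed (rule main; assumption)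
qed

text \<open>One step of the Lyapunov estimate already bounds B w by y = B w - s w, and then s w = B
  w - y is bounded too. This prepares the solvability of the implicit step without a resolvent
  formula.\<close>

lemma bounded_below:
  assumes s: "s > 0"
  obtains C where "C > 0" "\<And>w. norm w \<le> C * norm (B w - s *\<^sub>R w)"
proof -
  obtain V C where V: "C > 0" "\<And>x. 0 \<le> V x" "\<And>x. V x \<le> C * (norm x)\<^sup>2"
    "\<And>w s. s > 0 \<Longrightarrow> V (B w + s *\<^sub>R w) - V (B w - s *\<^sub>R w) \<le> - s * (norm (B w))\<^sup>2"
    by (rule lyapunov_T) (rule that; assumption)
  have "norm w \<le> ((sqrt (C / s) + 1) / s) * norm (B w - s *\<^sub>R w)" for w
  proof -
    let ?y = "B w - s *\<^sub>R w"
    have "s * (norm (B w))\<^sup>2 \<le> C * (norm ?y)\<^sup>2"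
      using V(4)[OF s, of w] V(2)[of "B w + s *\<^sub>R w"] V(3)[of ?y] by linarith
    then have "(norm (B w))\<^sup>2 \<le> C / s * (norm ?y)\<^sup>2" using s by (simp add: field_simps)
    also have "\<dots> = (sqrt (C / s) * norm ?y)\<^sup>2" using V(1) s by (simp add: power_mult_distrib)
    finally have "norm (B w) \<le> sqrt (C / s) * norm ?y"
      by (rule power2_le_imp_le) (use V(1) s in simp)
    moreover have "s * norm w \<le> norm (B w) + norm ?y"
      using norm_triangle_ineq4[of "B w" ?y] s by simp
    ultimately have "s * norm w \<le> (sqrt (C / s) + 1) * norm ?y" by (simp add: distrib_right)
    then show ?thesis using s by (simp add: pos_le_divide_eq mult.commute)
  qed
  moreover have "(sqrt (C / s) + 1) / s > 0" using V(1) s by (simp add: add_nonneg_pos)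
  ultimately show thesis by (intro that)
qed

end

section \<open>Duality\<close>

lemma vector_derivative_weak_bound:
  fixes X :: "real \<Rightarrow> 'a::real_inner"
  assumes X: "\<And>r. r \<in> I \<Longrightarrow> (X has_vector_derivative Y r) (at r within I)" and I: "convex I"
    and le: "\<And>r. r \<in> I \<Longrightarrow> \<bar>inner (Y r) v\<bar> \<le> c" and st: "s \<in> I" "t \<in> I"
  shows "\<bar>inner (X s - X t) v\<bar> \<le> c * \<bar>s - t\<bar>"
proof -
  have "norm (inner (X s) v - inner (X t) v) \<le> c * norm (s - t)"
  proof (rule field_differentiable_bound[OF I _ _ st])
    fix r assume r: "r \<in> I"
    have "((\<lambda>r. inner (X r) v) has_vector_derivative inner (Y r) v) (at r within I)"
      by (rule bounded_linear.has_vector_derivative[OF bounded_linear_inner_left X[OF r]])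
    then show "((\<lambda>r. inner (X r) v) has_field_derivative inner (Y r) v) (at r within I)"
      by (simp add: has_real_derivative_iff_has_vector_derivative)
    show "norm (inner (Y r) v) \<le> c" using le[OF r] by simp
  qed
  then show ?thesis by (simp add: inner_diff_left)
qed

text \<open>An orbit of the adjoint family is differentiable as soon as the candidate derivative is
  continuous, because the error bound is uniform in the test vector.\<close>

lemma adjoint_vector_derivative:
  fixes X Y :: "real \<Rightarrow> 'a::real_inner \<Rightarrow> 'a"
  assumes X: "\<And>t u. t \<ge> 0 \<Longrightarrow> ((\<lambda>t. X t u) has_vector_derivative Y t u) (at t within {0..})"
    and p: "\<And>t u. t \<ge> 0 \<Longrightarrow> inner (X t u) v = inner u (p t)"
    and q: "\<And>t u. t \<ge> 0 \<Longrightarrow> inner (Y t u) v = inner u (q t)"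
    and cont: "continuous_on {0..} q" and t: "t \<ge> 0"
  shows "(p has_vector_derivative q t) (at t within {0..})"
  unfolding has_vector_derivative_def has_derivative_within_alt
proof (intro conjI allI impI bounded_linear_scaleR_left)
  fix e :: real assume e: "e > 0"
  obtain d where d: "d > 0" "\<And>s. s \<ge> 0 \<Longrightarrow> dist s t < d \<Longrightarrow> dist (q s) (q t) < e"
    using cont[unfolded continuous_on_iff, rule_format, of t e] t e by auto
  define I where "I = {0..} \<inter> {t - d <..< t + d}"
  have I: "convex I" unfolding I_def by (intro convex_Int) auto
  have "norm (p s - p t - (s - t) *\<^sub>R q t) \<le> e * norm (s - t)" if s: "s \<ge> 0" "norm (s - t) < d" for s
  proof (rule norm_le_if_inner_le)
    fix u
    have "\<bar>inner (X s u - X t u) v - (s - t) * inner u (q t)\<bar> \<le> e * norm u * \<bar>s - t\<bar>"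
    proof -
      have "norm ((inner (X s u) v - s * inner u (q t)) - (inner (X t u) v - t * inner u (q t)))
          \<le> e * norm u * norm (s - t)"
      proof (rule field_differentiable_bound[OF I])
        fix r assume r: "r \<in> I"
        then have r0: "r \<ge> 0" "dist r t < d" by (auto simp: I_def dist_real_def)
        have "((\<lambda>t. X t u) has_vector_derivative Y r u) (at r within I)"
          by (rule has_vector_derivative_within_subset[OF X[OF r0(1)]]) (auto simp: I_def)
        then have "((\<lambda>r. inner (X r u) v) has_vector_derivative inner (Y r u) v) (at r within I)"
          by (rule bounded_linear.has_vector_derivative[OF bounded_linear_inner_left])
        then have "((\<lambda>r. inner (X r u) v) has_field_derivative inner (Y r u) v) (at r within I)"
          by (simp add: has_real_derivative_iff_has_vector_derivative)
        then show "((\<lambda>r. inner (X r u) v - r * inner u (q t)) has_field_derivative inner u (q r - q t))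
            (at r within I)"
          by (auto intro!: derivative_eq_intros simp: q[OF r0(1)] inner_diff_right)
        have "\<bar>inner u (q r - q t)\<bar> \<le> norm u * norm (q r - q t)" by (rule Cauchy_Schwarz_ineq2)
        also have "\<dots> \<le> norm u * e"
          using d(2)[OF r0] by (intro mult_left_mono) (auto simp: dist_norm)
        finally show "norm (inner u (q r - q t)) \<le> e * norm u" by (simp add: mult.commute)
      qed (use s t d(1) in \<open>auto simp: I_def\<close>)
      then show ?thesis by (simp add: inner_diff_left algebra_simps)
    qed
    then show "\<bar>inner u (p s - p t - (s - t) *\<^sub>R q t)\<bar> \<le> e * norm (s - t) * norm u"
      using s(1) t by (simp add: inner_diff_left inner_diff_right p mult_ac)
  qed (use e in auto)
  then show "\<exists>d>0. \<forall>s\<in>{0..}. norm (s - t) < d \<longrightarrow> norm (p s - p t - (s - t) *\<^sub>R q t) \<le> e * norm (s - t)"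
    using d(1) by (intro exI[of _ d]) auto
qed

text \<open>The lower bound makes the range closed, and injectivity of the adjoint g makes it
  dense.\<close>

lemma surj_if_bounded_below:
  fixes f g :: "'a::{real_inner, complete_space} \<Rightarrow> 'a"
  assumes f: "bounded_linear f" and g: "bounded_linear g"
    and adj: "\<And>x y. inner (f x) y = inner x (g y)"
    and below: "\<And>w. norm w \<le> C * norm (f w)" and C: "C > 0"
    and inj: "\<And>w. g w = 0 \<Longrightarrow> w = 0"
  shows "surj f"
proof -
  have "adjoint g = f" by (rule adjoint_unique) (metis adj inner_commute)
  then have dense: "closure (range f) = UNIV" using dense_range_adjoint[OF g inj] by simp
  have "complete (range f)"
  proof (rule complete_isometric_image[of "1 / C" UNIV f])
    show "\<forall>x\<in>UNIV. 1 / C * norm x \<le> norm (f x)" using below C by (auto simp: field_simps)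
    show "complete (UNIV :: 'a set)"
      by (simp add: complete_def) (metis Cauchy_convergent convergent_def)
  qed (use C f in auto)
  then have "closed (range f)" by (rule complete_imp_closed)
  then show ?thesis using dense by simp
qed

lemma bounded_linear_if_norm_le:
  assumes "linear f" "\<And>x. norm (f x) \<le> c * norm x"
  shows "bounded_linear f"
  using assms by (auto simp: bounded_linear_def bounded_linear_axioms_def mult.commute)

text \<open>The added axioms are what passing to adjoints requires: commutation turns the adjoint of
  T(t) B into the adjoint of T(t) after that of B, and injectivity of B makes the range of its
  adjoint dense.\<close>

locale cayley_adjoint_pair = cayley_pair T S B K \<omega> M b
  for T S :: "real \<Rightarrow> 'a::{real_inner, complete_space} \<Rightarrow> 'a" and B K \<omega> M b +
  assumes TB: "t \<ge> 0 \<Longrightarrow> T t (B x) = B (T t x)" and SB: "t \<ge> 0 \<Longrightarrow> S t (B x) = B (S t x)"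
    and B_inj: "B x = 0 \<Longrightarrow> x = 0"
begin

lemma T_bl: "t \<ge> 0 \<Longrightarrow> bounded_linear (T t)"
  by (rule bounded_linear_if_norm_le[OF T_lin T_le'])

lemma S_bl: "t \<ge> 0 \<Longrightarrow> bounded_linear (S t)"
  by (rule bounded_linear_if_norm_le[OF S_lin S_le])

lemma B_bl: "bounded_linear B"
  by (rule bounded_linear_if_norm_le[OF B_lin B_le])

text \<open>Strong continuity does not pass to adjoints formally. On vectors
  \<open>adjoint B w\<close> the orbit is Lipschitz, because <T(t) B u, w> has derivative <T(t) u,
  w>, bounded by K |u| |w|; density of these vectors and the uniform bound K do the rest.\<close>

lemma adj_T_cont: "continuous_on {0..} (\<lambda>t. adjoint (T t) v)"
  unfolding continuous_on_iff
proof (intro ballI allI impI)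
  fix t e :: real assume t': "t \<in> {0..}" and e: "e > 0"
  then have t: "t \<ge> 0" by simp
  have "v \<in> closure (range (adjoint B))" using dense_range_adjoint[OF B_bl B_inj] by simp
  then obtain w where w: "dist (adjoint B w) v < e / (3 * K)"
    using e pos unfolding closure_approachable by fastforce
  define v' where "v' = adjoint B w"
  have Kv: "K * norm (v - v') \<le> e / 3"
    using w pos by (simp add: v'_def dist_norm norm_minus_commute field_simps)
  have lip: "norm (adjoint (T s) v' - adjoint (T t) v') \<le> (K * norm w) * \<bar>s - t\<bar>" if s: "s \<ge> 0" for s
  proof (rule norm_le_if_inner_le)
    fix u
    have "\<bar>inner (T s (B u) - T t (B u)) w\<bar> \<le> (K * norm u * norm w) * \<bar>s - t\<bar>"
    proof (rule vector_derivative_weak_bound[OF T_deriv])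
      fix r :: real assume "r \<in> {0..}"
      then have "norm (T r u) * norm w \<le> K * norm u * norm w"
        by (intro mult_right_mono T_le') auto
      then show "\<bar>inner (T r u) w\<bar> \<le> K * norm u * norm w"
        using Cauchy_Schwarz_ineq2[of "T r u" w] by linarith
    qed (use s t in auto)
    moreover have "inner (T s (B u) - T t (B u)) w = inner u (adjoint (T s) v' - adjoint (T t) v')"
      using s t by (simp add: TB inner_diff_left inner_diff_right v'_def hilbert_adjoint[OF B_bl]
          hilbert_adjoint[OF T_bl])
    ultimately show "\<bar>inner u (adjoint (T s) v' - adjoint (T t) v')\<bar> \<le> (K * norm w) * \<bar>s - t\<bar> * norm u"
      by (simp add: mult_ac)
  qed (use pos in auto)
  have adj_le: "norm (adjoint (T s) v - adjoint (T s) v') \<le> e / 3" if "s \<ge> 0" for s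
    using norm_hilbert_adjoint_le[OF T_bl T_le', OF that that, of "v - v'"] pos Kv
    by (simp add: linear_diff[OF linear_hilbert_adjoint[OF T_bl[OF that]]])
  define d where "d = e / (3 * (K * norm w + 1))"
  have Kw: "K * norm w \<ge> 0" using pos by simp
  have d: "d > 0" using e Kw by (simp add: d_def add_nonneg_pos)
  have "dist (adjoint (T s) v) (adjoint (T t) v) < e" if s: "s \<in> {0..}" "dist s t < d" for s
  proof -
    have "(K * norm w) * \<bar>s - t\<bar> \<le> (K * norm w) * d"
      using s pos by (intro mult_left_mono) (auto simp: dist_real_def)
    also have "\<dots> < e / 3" using e Kw by (simp add: d_def field_simps)
    finally have mid: "norm (adjoint (T s) v' - adjoint (T t) v') < e / 3" using lip[of s] s by simp
    define a m z where "a = adjoint (T s) v - adjoint (T s) v'"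
      and "m = adjoint (T s) v' - adjoint (T t) v'" and "z = adjoint (T t) v - adjoint (T t) v'"
    have "norm a \<le> e / 3" "norm z \<le> e / 3" "norm m < e / 3"
      unfolding a_def z_def m_def using adj_le s t mid by auto
    then have "norm a + norm m + norm z < e" by linarith
    then have "norm (a + m - z) < e"
      using norm_triangle_ineq4[of "a + m" z] norm_triangle_ineq[of a m] by linarith
    then show ?thesis by (simp add: dist_norm a_def m_def z_def)
  qed
  then show "\<exists>d>0. \<forall>s\<in>{0..}. dist s t < d \<longrightarrow> dist (adjoint (T s) v) (adjoint (T t) v) < e"
    using d by blast
qed

text \<open>The generator B of S is bounded, so every adjoint orbit is Lipschitz and density is
  avoided.\<close>

lemma adj_S_cont: "continuous_on {0..} (\<lambda>t. adjoint (S t) v)"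
proof (rule lipschitz_on_continuous_on[where L="M * b * norm v"], rule lipschitz_onI)
  fix s t :: real assume "s \<in> {0..}" "t \<in> {0..}"
  then have st: "s \<ge> 0" "t \<ge> 0" by auto
  show "dist (adjoint (S s) v) (adjoint (S t) v) \<le> M * b * norm v * dist s t"
    unfolding dist_norm
  proof (rule norm_le_if_inner_le)
    fix u
    have "\<bar>inner (S s u - S t u) v\<bar> \<le> (M * b * norm u * norm v) * \<bar>s - t\<bar>"
    proof (rule vector_derivative_weak_bound[OF S_deriv])
      fix r :: real assume "r \<in> {0..}"
      then have "norm (S r (B u)) \<le> M * norm (B u)" by (intro S_le) auto
      also have "\<dots> \<le> M * (b * norm u)" using pos by (intro mult_left_mono B_le) auto
      finally have "norm (S r (B u)) * norm v \<le> M * (b * norm u) * norm v"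
        by (rule mult_right_mono) simp
      then show "\<bar>inner (S r (B u)) v\<bar> \<le> M * b * norm u * norm v"
        using Cauchy_Schwarz_ineq2[of "S r (B u)" v] by (simp add: mult.assoc)
    qed (use st in auto)
    moreover have "inner (S s u - S t u) v = inner u (adjoint (S s) v - adjoint (S t) v)"
      using st by (simp add: inner_diff_left inner_diff_right hilbert_adjoint[OF S_bl])
    ultimately show "\<bar>inner u (adjoint (S s) v - adjoint (S t) v)\<bar> \<le> M * b * norm v * norm (s - t) * norm u"
      by (simp add: mult_ac)
  qed (use pos in auto)
qed (use pos in auto)

text \<open>All constants are the same for the adjoints, so each Lyapunov estimate becomes available
  for the dual scheme.\<close>

sublocale adj: cayley_pair "\<lambda>t. adjoint (T t)" "\<lambda>t. adjoint (S t)" "adjoint B" K \<omega> M b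
proof (rule cayley_pair.intro)
  show "linear (adjoint (T t))" if "t \<ge> 0" for t by (rule linear_hilbert_adjoint[OF T_bl[OF that]])
  show "linear (adjoint (S t))" if "t \<ge> 0" for t by (rule linear_hilbert_adjoint[OF S_bl[OF that]])
  fix t :: real and x assume t: "t \<ge> 0"
  show "norm (adjoint (T t) x) \<le> K * exp (- \<omega> * t) * norm x"
    using pos by (intro norm_hilbert_adjoint_le T_bl T_le t) auto
  show "norm (adjoint (S t) x) \<le> M * norm x"
    using pos by (intro norm_hilbert_adjoint_le S_bl S_le t) auto
  have cB: "adjoint (S t) (adjoint B x) = adjoint B (adjoint (S t) x)" if "t \<ge> 0" for t
    by (rule eq_if_inner_eq)
      (use that in \<open>simp add: SB flip: hilbert_adjoint[OF B_bl] hilbert_adjoint[OF S_bl]\<close>)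
  show "((\<lambda>t. adjoint (T t) (adjoint B x)) has_vector_derivative adjoint (T t) x) (at t within {0..})"
    by (rule adjoint_vector_derivative[where v=x and X="\<lambda>t u. T t (B u)" and Y=T, OF T_deriv])
      (use t in \<open>simp_all add: TB hilbert_adjoint[OF T_bl] hilbert_adjoint[OF B_bl] adj_T_cont\<close>)
  show "((\<lambda>t. adjoint (S t) x) has_vector_derivative adjoint (S t) (adjoint B x)) (at t within {0..})"
  proof (rule adjoint_vector_derivative[where v=x and X=S and Y="\<lambda>t u. S t (B u)", OF S_deriv])
    show "inner (S t (B u)) x = inner u (adjoint (S t) (adjoint B x))" if "t \<ge> 0" for t u
      using that by (simp add: SB hilbert_adjoint[OF S_bl] hilbert_adjoint[OF B_bl])
  qed (use t in \<open>simp_all add: hilbert_adjoint[OF S_bl] adj_S_cont\<close>)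
next
  show "linear (adjoint B)" by (rule linear_hilbert_adjoint[OF B_bl])
  show "norm (adjoint B x) \<le> b * norm x" for x
    using pos by (intro norm_hilbert_adjoint_le B_bl B_le) auto
  show "adjoint (T 0) x = x" for x
    by (rule eq_if_inner_eq) (use hilbert_adjoint[OF T_bl, of 0] in \<open>simp add: T_id\<close>)
  show "adjoint (S 0) x = x" for x
    by (rule eq_if_inner_eq) (use hilbert_adjoint[OF S_bl, of 0] in \<open>simp add: S_id\<close>)
qed (use pos in \<open>auto intro: adj_T_cont adj_S_cont\<close>)

lemma adj_B_bl: "bounded_linear (adjoint B)"
  by (rule bounded_linear_if_norm_le[OF adj.B_lin adj.B_le])

lemma B_minus_inj:
  assumes "s > 0" "B w - s *\<^sub>R w = 0"
  shows "w = 0"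
proof (rule bounded_below[OF assms(1)])
  fix C assume "\<And>w. norm w \<le> C * norm (B w - s *\<^sub>R w)"
  from this[of w] show ?thesis by (simp add: assms(2))
qed

lemma adj_B_minus_inj:
  assumes "s > 0" "adjoint B w - s *\<^sub>R w = 0"
  shows "w = 0"
proof (rule adj.bounded_below[OF assms(1)])
  fix C assume "\<And>w. norm w \<le> C * norm (adjoint B w - s *\<^sub>R w)"
  from this[of w] show ?thesis by (simp add: assms(2))
qed

lemma B_minus_bl: "bounded_linear (\<lambda>w. B w - s *\<^sub>R w)" "bounded_linear (\<lambda>w. adjoint B w - s *\<^sub>R w)"
  by (intro bounded_linear_sub B_bl adj_B_bl bounded_linear_scaleR_right)+

lemma B_minus_adj: "inner (B x - s *\<^sub>R x) y = inner x (adjoint B y - s *\<^sub>R y)"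
  by (simp add: inner_diff_left inner_diff_right hilbert_adjoint[OF B_bl])

lemma B_minus_surj:
  assumes s: "s > 0"
  shows "surj (\<lambda>w. B w - s *\<^sub>R w)"
proof -
  obtain C where C: "C > 0" "\<And>w. norm w \<le> C * norm (B w - s *\<^sub>R w)"
    by (rule bounded_below[OF s]) (rule that; assumption)
  show ?thesis
    by (rule surj_if_bounded_below[OF B_minus_bl B_minus_adj C(2,1)]) (rule adj_B_minus_inj[OF s])
qed

lemma adj_B_minus_surj:
  assumes s: "s > 0"
  shows "surj (\<lambda>w. adjoint B w - s *\<^sub>R w)"
proof -
  obtain C where C: "C > 0" "\<And>w. norm w \<le> C * norm (adjoint B w - s *\<^sub>R w)"
    by (rule adj.bounded_below[OF s]) (rule that; assumption)
  show ?thesis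
    by (rule surj_if_bounded_below[OF B_minus_bl(2,1) _ C(2,1)])
      (use B_minus_adj B_minus_inj[OF s] in \<open>auto simp: inner_commute\<close>)
qed

lemma orbit_exists:
  assumes "\<And>k. s k > 0"
  obtains w x where "x 0 = x0" "cayley_orbit s w x"
proof -
  have "\<exists>w. B w - s k *\<^sub>R w = y" for k y
    using surjD[OF B_minus_surj[OF assms], of y k] by metis
  then obtain W where W: "\<And>k y. B (W k y) - s k *\<^sub>R W k y = y" by metis
  define x where "x = rec_nat x0 (\<lambda>k y. B (W k y) + s k *\<^sub>R W k y)"
  show thesis
    by (rule that[of x "\<lambda>k. W k (x k)"]) (auto simp: x_def cayley_orbit_def W)
qed

lemma adj_orbit_exists:
  assumes "\<And>k. s k > 0"
  obtains w x where "x 0 = x0" "adj.cayley_orbit s w x"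
proof -
  have "\<exists>w. adjoint B w - s k *\<^sub>R w = y" for k y
    using surjD[OF adj_B_minus_surj[OF assms], of y k] by metis
  then obtain W where W: "\<And>k y. adjoint B (W k y) - s k *\<^sub>R W k y = y" by metis
  define x where "x = rec_nat x0 (\<lambda>k y. adjoint B (W k y) + s k *\<^sub>R W k y)"
  show thesis
    by (rule that[of x "\<lambda>k. W k (x k)"]) (auto simp: x_def adj.cayley_orbit_def W)
qed

lemma orbit_unique:
  assumes s: "\<And>k. s k > 0" and "cayley_orbit s w x" "cayley_orbit s w' x'" "x 0 = x' 0"
  shows "x k = x' k"
proof (induction k)
  case (Suc k)
  have "B (w k - w' k) - s k *\<^sub>R (w k - w' k) = x k - x' k"
    unfolding cayley_orbitD(1)[OF assms(2)] cayley_orbitD(1)[OF assms(3)]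
    by (simp add: linear_diff[OF B_lin] algebra_simps)
  also have "\<dots> = 0" using Suc by simp
  finally have "w k - w' k = 0" by (rule B_minus_inj[OF s])
  then show ?case by (simp add: cayley_orbitD(2)[OF assms(2)] cayley_orbitD(2)[OF assms(3)])
qed (use assms in simp)

text \<open>If \<open>v\<close> runs backwards along the adjoint scheme then \<open>\<langle>x\<^sub>k, v\<^sub>k\<rangle>\<close> does not depend on \<open>k\<close>;
  averaging over \<open>k\<close> turns the two quadratic sums into a pointwise bound.\<close>

lemma norm_sq_le_sum_sq:
  assumes c: "c > 0"
  obtains C where "C > 0" "\<And>s w x N. \<forall>k. c \<le> s k \<and> s k \<le> d \<Longrightarrow> cayley_orbit s w x \<Longrightarrow>
    real (Suc N) * (norm (x N))\<^sup>2 \<le> C * (\<Sum>k<Suc N. (norm (x k))\<^sup>2)"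
proof -
  obtain C where C: "C > 0" "\<And>s w x N. \<forall>k. c \<le> s k \<and> s k \<le> d \<Longrightarrow> adj.cayley_orbit s w x \<Longrightarrow>
    (\<Sum>k<N. (norm (x k))\<^sup>2) \<le> C * real N * (norm (x 0))\<^sup>2"
    by (rule adj.sum_sq_orbit_le[OF c]) (rule that; assumption)
  have main: "real (Suc N) * (norm (x N))\<^sup>2 \<le> C * (\<Sum>k<Suc N. (norm (x k))\<^sup>2)"
    if s: "\<forall>k. c \<le> s k \<and> s k \<le> d" and x: "cayley_orbit s w x" for s w x N
  proof (cases "x N = 0")
    case False
    \<comment> \<open>Step sizes in reverse order. For j >= N truncated subtraction repeats
      \<open>s 0\<close>, which keeps the bounds valid for all indices.\<close>
    define s' where "s' j = s (N - Suc j)" for j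
    have s': "\<forall>k. c \<le> s' k \<and> s' k \<le> d" using s by (simp add: s'_def)
    have "s' k > 0" for k using s' c by (meson less_le_trans)
    then obtain v u where u: "u 0 = x N" "adj.cayley_orbit s' v u"
      by (rule adj_orbit_exists) (rule that; assumption)
    have pair: "inner (x (N - j)) (u j) = (norm (x N))\<^sup>2" if "j \<le> N" for j
      using that
    proof (induction j)
      case (Suc j)
      define k where "k = N - Suc j"
      have k: "N - j = Suc k" "s' j = s k" using Suc.prems by (auto simp: k_def s'_def)
      \<comment> \<open>Both sides equal <B w, B' v> - s^2 <w, v>, where B' is the adjoint of B, w
        belongs to x at k and v to u at j; the mixed terms cancel since <B w, v> = <w, B'
        v>.\<close>
      have "inner (x k) (u (Suc j)) = inner (x (Suc k)) (u j)"
        unfolding cayley_orbitD(1)[OF x, of k] cayley_orbitD(2)[OF x, of k]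
          adj.cayley_orbitD(1)[OF u(2), of j] adj.cayley_orbitD(2)[OF u(2), of j] k(2)
        by (simp add: inner_add inner_diff hilbert_adjoint[OF B_bl] algebra_simps)
      then show ?case using Suc k by (simp add: k_def)
    qed (use u in \<open>simp add: power2_norm_eq_inner\<close>)
    have "real (Suc N) * (norm (x N))\<^sup>2 = (\<Sum>j<Suc N. inner (x (N - j)) (u j))"
      using pair by (simp add: sum.cong)
    also have "\<dots> \<le> (\<Sum>j<Suc N. norm (x (N - j)) * norm (u j))"
      by (intro sum_mono norm_cauchy_schwarz)
    finally have "(real (Suc N) * (norm (x N))\<^sup>2)\<^sup>2 \<le> (\<Sum>j<Suc N. norm (x (N - j)) * norm (u j))\<^sup>2"
      by (intro power_mono) auto
    also have "\<dots> \<le> (\<Sum>j<Suc N. (norm (x (N - j)))\<^sup>2) * (\<Sum>j<Suc N. (norm (u j))\<^sup>2)"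
      by (rule Cauchy_Schwarz_ineq_sum)
    also have "(\<Sum>j<Suc N. (norm (x (N - j)))\<^sup>2) = (\<Sum>k<Suc N. (norm (x k))\<^sup>2)"
      using sum.nat_diff_reindex[of "\<lambda>k. (norm (x k))\<^sup>2" "Suc N"] by simp
    also have "(\<Sum>k<Suc N. (norm (x k))\<^sup>2) * (\<Sum>j<Suc N. (norm (u j))\<^sup>2)
        \<le> (\<Sum>k<Suc N. (norm (x k))\<^sup>2) * (C * real (Suc N) * (norm (x N))\<^sup>2)"
      using C(2)[OF s' u(2), of "Suc N"] u(1) by (intro mult_left_mono sum_nonneg) auto
    \<comment> \<open>The dual sum is itself bounded by (N + 1) |x_N|^2, so one factor of the square
      cancels; this is why x_N = 0 is split off.\<close>
    finally have "(real (Suc N) * (norm (x N))\<^sup>2) * (real (Suc N) * (norm (x N))\<^sup>2)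
        \<le> (real (Suc N) * (norm (x N))\<^sup>2) * (C * (\<Sum>k<Suc N. (norm (x k))\<^sup>2))"
      by (simp add: power2_eq_square mult_ac)
    then show ?thesis by (rule mult_left_le_imp_le) (use False in simp)
  qed (use C in \<open>simp add: sum_nonneg\<close>)
  show thesis by (rule that[OF C(1)]) (rule main; assumption)
qed

lemma orbit_bounded:
  assumes c: "c > 0"
  obtains C where "C > 0" "\<And>s w x N. \<forall>k. c \<le> s k \<and> s k \<le> d \<Longrightarrow> cayley_orbit s w x \<Longrightarrow>
    (norm (x N))\<^sup>2 \<le> C * (norm (x 0))\<^sup>2"
proof -
  obtain C where C: "C > 0" "\<And>s w x N. \<forall>k. c \<le> s k \<and> s k \<le> d \<Longrightarrow> cayley_orbit s w x \<Longrightarrow>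
    (\<Sum>k<N. (norm (x k))\<^sup>2) \<le> C * real N * (norm (x 0))\<^sup>2"
    by (rule sum_sq_orbit_le[OF c]) (rule that; assumption)
  obtain C' where C': "C' > 0" "\<And>s w x N. \<forall>k. c \<le> s k \<and> s k \<le> d \<Longrightarrow> cayley_orbit s w x \<Longrightarrow>
    real (Suc N) * (norm (x N))\<^sup>2 \<le> C' * (\<Sum>k<Suc N. (norm (x k))\<^sup>2)"
    by (rule norm_sq_le_sum_sq[OF c]) (rule that; assumption)
  have main: "(norm (x N))\<^sup>2 \<le> C' * C * (norm (x 0))\<^sup>2"
    if s: "\<forall>k. c \<le> s k \<and> s k \<le> d" and x: "cayley_orbit s w x" for s w x N
  proof -
    have "real (Suc N) * (norm (x N))\<^sup>2 \<le> C' * (\<Sum>k<Suc N. (norm (x k))\<^sup>2)" by (rule C'(2)[OF s x])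
    also have "\<dots> \<le> C' * (C * real (Suc N) * (norm (x 0))\<^sup>2)"
      using C'(1) by (intro mult_left_mono C(2)[OF s x]) auto
    finally have "real (Suc N) * (norm (x N))\<^sup>2 \<le> real (Suc N) * (C' * C * (norm (x 0))\<^sup>2)"
      by (simp only: mult_ac)
    then show ?thesis by (rule mult_left_le_imp_le) simp
  qed
  show thesis
  proof (rule that)
    show "C' * C > 0" using C C' by simp
  qed (rule main; assumption)
qed

text \<open>By uniqueness x = B z, where z is the trajectory from y. If v drives z, then x_k = (B -
  s_k) B v_k, so |x_k| is at most (b + d) |B v_k|, and these squares have a sum bounded
  independently of N.\<close>

lemma orbit_decay:
  assumes c: "c > 0"
  obtains C where "C > 0" "\<And>s w x y N. \<forall>k. c \<le> s k \<and> s k \<le> d \<Longrightarrow> cayley_orbit s w x \<Longrightarrow> x 0 = B y \<Longrightarrow>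
    real (Suc N) * (norm (x N))\<^sup>2 \<le> C * (norm y)\<^sup>2"
proof -
  obtain C where C: "C > 0" "\<And>s w x N. \<forall>k. c \<le> s k \<Longrightarrow> cayley_orbit s w x \<Longrightarrow>
    (\<Sum>k<N. (norm (B (w k)))\<^sup>2) \<le> C * (norm (x 0))\<^sup>2"
    by (rule sum_sq_B_le[OF c]) (rule that; assumption)
  obtain C' where C': "C' > 0" "\<And>s w x N. \<forall>k. c \<le> s k \<and> s k \<le> d \<Longrightarrow> cayley_orbit s w x \<Longrightarrow>
    real (Suc N) * (norm (x N))\<^sup>2 \<le> C' * (\<Sum>k<Suc N. (norm (x k))\<^sup>2)"
    by (rule norm_sq_le_sum_sq[OF c]) (rule that; assumption)
  define C'' where "C'' = C' * ((b + d)\<^sup>2 * C)"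
  have main: "real (Suc N) * (norm (x N))\<^sup>2 \<le> C'' * (norm y)\<^sup>2"
    if s: "\<forall>k. c \<le> s k \<and> s k \<le> d" and x: "cayley_orbit s w x" and x0: "x 0 = B y" for s w x y N
  proof -
    have s_pos: "s k > 0" for k using s c by (meson less_le_trans)
    then obtain v z where z: "z 0 = y" "cayley_orbit s v z"
      by (rule orbit_exists) (rule that; assumption)
    have Bz: "cayley_orbit s (\<lambda>k. B (v k)) (\<lambda>k. B (z k))"
      unfolding cayley_orbit_def
    proof (intro allI conjI)
      fix k
      show "B (z k) = B (B (v k)) - s k *\<^sub>R B (v k)"
        unfolding cayley_orbitD(1)[OF z(2), of k]
        by (simp add: linear_diff[OF B_lin] linear_scale[OF B_lin])
      show "B (z (Suc k)) = B (B (v k)) + s k *\<^sub>R B (v k)"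
        unfolding cayley_orbitD(2)[OF z(2), of k]
        by (simp add: linear_add[OF B_lin] linear_scale[OF B_lin])
    qed
    have xz: "x k = B (B (v k)) - s k *\<^sub>R B (v k)" for k
      using orbit_unique[OF s_pos x Bz, of k] cayley_orbitD(1)[OF Bz, of k] x0 z(1) by simp
    have "(norm (x k))\<^sup>2 \<le> (b + d)\<^sup>2 * (norm (B (v k)))\<^sup>2" for k
    proof -
      have "norm (x k) \<le> norm (B (B (v k))) + s k * norm (B (v k))"
        unfolding xz using norm_triangle_ineq4[of "B (B (v k))" "s k *\<^sub>R B (v k)"] s_pos[of k] by simp
      also have "\<dots> \<le> b * norm (B (v k)) + d * norm (B (v k))"
        using s by (intro add_mono B_le mult_right_mono) auto
      finally have "norm (x k) \<le> (b + d) * norm (B (v k))" by (simp add: distrib_right)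
      then have "(norm (x k))\<^sup>2 \<le> ((b + d) * norm (B (v k)))\<^sup>2" by (intro power_mono) auto
      then show ?thesis by (simp add: power_mult_distrib)
    qed
    then have "(\<Sum>k<Suc N. (norm (x k))\<^sup>2) \<le> (b + d)\<^sup>2 * (\<Sum>k<Suc N. (norm (B (v k)))\<^sup>2)"
      unfolding sum_distrib_left by (intro sum_mono)
    also have "\<dots> \<le> (b + d)\<^sup>2 * (C * (norm y)\<^sup>2)"
      using C(2)[OF _ z(2), of "Suc N"] s z(1) by (intro mult_left_mono) auto
    finally have "C' * (\<Sum>k<Suc N. (norm (x k))\<^sup>2) \<le> C' * ((b + d)\<^sup>2 * (C * (norm y)\<^sup>2))"
      using C'(1) by (intro mult_left_mono) auto
    then show ?thesis using C'(2)[OF s x, of N] by (simp add: C''_def mult_ac)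
  qed
  show thesis
  \<comment> \<open>For c <= d the constant is positive because b + d > 0; otherwise no step
    sequence is admissible and any positive constant works.\<close>
  proof (cases "c \<le> d")
    case True
    show thesis
    proof (rule that)
      show "C'' > 0" using True C C' pos c by (simp add: C''_def)
    qed (rule main; assumption)
  next
    case False
    show thesis
    proof (rule that)
      show "(1::real) > 0" by simp
    qed (use False in \<open>meson order_trans\<close>)
  qed
qed

end

section \<open>Fractional powers\<close>

context stable_C0_semigroup
begin

lemma gen_inv:
  shows gen_inv_dom: "gen_inv T y \<in> gen_dom T" and gen_gen_inv: "gen T (gen_inv T y) = y"
proof -
  obtain x where x: "x \<in> gen_dom T" "gen T x = y" by (rule gen_surj)
  have "x' = x" if "x' \<in> gen_dom T \<and> gen T x' = y" for x'
  proof -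
    have "x' - x \<in> gen_dom T" "gen T (x' - x) = 0"
      using gen_linear[of x' x 1 "-1"] that x by auto
    then have "x' - x = 0" by (rule gen_inj)
    then show ?thesis by simp
  qed
  then have "\<exists>!x. x \<in> gen_dom T \<and> gen T x = y" using x by blast
  then have "gen_inv T y \<in> gen_dom T \<and> gen T (gen_inv T y) = y"
    unfolding gen_inv_def by (rule theI')
  then show "gen_inv T y \<in> gen_dom T" "gen T (gen_inv T y) = y" by auto
qed

lemma gen_injD:
  assumes "x \<in> gen_dom T" "x' \<in> gen_dom T" "gen T x = gen T x'"
  shows "x = x'"
proof -
  have "x - x' \<in> gen_dom T" "gen T (x - x') = 0"
    using gen_linear[of x x' 1 "-1"] assms by auto
  then have "x - x' = 0" by (rule gen_inj)
  then show ?thesis by simp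
qed

lemma gen_inv_gen: "x \<in> gen_dom T \<Longrightarrow> gen_inv T (gen T x) = x"
  by (rule gen_injD[OF gen_inv_dom]) (simp_all add: gen_gen_inv)

lemma gen_inv_linear: "linear (gen_inv T)"
proof (rule linearI)
  show "gen_inv T (x + y) = gen_inv T x + gen_inv T y" for x y
    by (rule gen_injD[OF gen_inv_dom])
      (use gen_linear[OF gen_inv_dom gen_inv_dom, of 1 x 1 y] gen_gen_inv in auto)
  show "gen_inv T (c *\<^sub>R x) = c *\<^sub>R gen_inv T x" for c x
    by (rule gen_injD[OF gen_inv_dom])
      (use gen_linear[OF gen_inv_dom gen_inv_dom, of c x 0 x] gen_gen_inv in auto)
qed

lemma gen_inv_eq_0: "gen_inv T x = 0 \<Longrightarrow> x = 0"
  using gen_gen_inv[of x] gen_gen_inv[of 0] linear_0[OF gen_inv_linear] by simp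

lemma gen_inv_commute: "t \<ge> 0 \<Longrightarrow> T t (gen_inv T x) = gen_inv T (T t x)"
  by (rule gen_injD[OF _ gen_inv_dom])
    (use gen_semigroup_commute[OF gen_inv_dom] gen_gen_inv in auto)

lemma gen_inv_orbit_derivative:
  "t \<ge> 0 \<Longrightarrow> ((\<lambda>t. T t (gen_inv T x)) has_vector_derivative T t x) (at t within {0..})"
  using orbit_derivative[OF gen_inv_dom, of t x] by (simp add: gen_gen_inv)

lemma gen_inv_orbit_derivative_at:
  "t > 0 \<Longrightarrow> ((\<lambda>t. T t (gen_inv T x)) has_vector_derivative T t x) (at t)"
  using gen_inv_orbit_derivative has_vector_derivative_at_within_Ici by (metis less_imp_le)

text \<open>For y = A^-1 x, T(L) y - y is the integral of T(t) x over [0, L], hence at most K L |x|.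
  A horizon L with |T(L) y| <= |y|/2 then bounds |y| itself.\<close>

lemma gen_inv_bounded:
  obtains b where "b > 0" "\<And>x. norm (gen_inv T x) \<le> b * norm x"
proof -
  \<comment> \<open>K + 1 keeps the argument of the logarithm positive, as only K >= 0 is known
    here.\<close>
  define L where "L = (\<bar>ln (2 * (K + 1))\<bar> + 1) / \<omega>"
  have L: "L > 0" using om by (simp add: L_def)
  have "ln (2 * (K + 1)) \<le> \<omega> * L" using om by (simp add: L_def)
  then have "exp (ln (2 * (K + 1))) \<le> exp (\<omega> * L)" by (subst exp_le_cancel_iff)
  then have "2 * (K + 1) \<le> exp (\<omega> * L)" using K_ge_0 by simp
  then have KL: "K * exp (- \<omega> * L) \<le> 1 / 2" by (simp add: exp_minus field_simps)
  have "norm (gen_inv T x) \<le> (2 * (K * L) + 1) * norm x" for x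
  proof -
    let ?y = "gen_inv T x"
    have "norm (T L ?y - T 0 ?y) \<le> K * norm x * L - K * norm x * 0"
    proof (rule differentiable_bound_general[OF L])
      show "continuous_on {0..L} (\<lambda>t. T t ?y)"
        by (rule continuous_on_subset[OF orbit_continuous]) auto
      show "continuous_on {0..L} (\<lambda>t. K * norm x * t)" by (intro continuous_intros)
      fix t assume t: "0 < t" "t < L"
      show "((\<lambda>t. T t ?y) has_vector_derivative T t x) (at t)"
        by (rule gen_inv_orbit_derivative_at[OF t(1)])
      show "((*) (K * norm x) has_vector_derivative K * norm x) (at t)"
        by (auto intro!: derivative_eq_intros)
      show "norm (T t x) \<le> K * norm x" using t by (intro norm_le) auto
    qed
    moreover have "norm (T L ?y) \<le> 1 / 2 * norm ?y"
      using norm_exp[of L ?y] L mult_right_mono[OF KL, of "norm ?y"] by simp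
    moreover have "norm ?y \<le> norm (T L ?y) + norm (T L ?y - ?y)"
      using norm_triangle_ineq4[of "T L ?y" "T L ?y - ?y"] by simp
    ultimately have "norm ?y \<le> 2 * (K * norm x * L)" unfolding T_0 by linarith
    also have "\<dots> = 2 * (K * L) * norm x" by simp
    also have "\<dots> \<le> (2 * (K * L) + 1) * norm x" by (simp add: distrib_right)
    finally show ?thesis .
  qed
  moreover have "2 * (K * L) + 1 > 0" using K_ge_0 L by (simp add: add_nonneg_pos)
  ultimately show thesis by (intro that)
qed

lemma orbit_has_integral: "((\<lambda>t. T t y) has_integral - gen_inv T y) {0..}"
proof (rule hilbert_has_integral_Ici_if_tendsto)
  show "continuous_on {0..} (\<lambda>t. T t (gen_inv T y) - gen_inv T y)"
    by (intro continuous_intros orbit_continuous)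
  show "((\<lambda>t. T t (gen_inv T y) - gen_inv T y) has_vector_derivative T t y) (at t)" if "t > 0" for t
    using has_vector_derivative_diff[OF gen_inv_orbit_derivative_at[OF that] has_vector_derivative_const]
    by simp
  show "((\<lambda>t. T t (gen_inv T y) - gen_inv T y) \<longlongrightarrow> - gen_inv T y) at_top"
    using tendsto_diff[OF orbit_tendsto_0 tendsto_const] by simp
qed (simp add: T_0)

lemma frac_neg_pow_has_integral:
  assumes "\<alpha> > 0"
  shows "((\<lambda>t. t powr (\<alpha> - 1) *\<^sub>R T t y) has_integral Gamma \<alpha> *\<^sub>R frac_neg_pow T \<alpha> y) {0..}"
proof -
  obtain I where I: "((\<lambda>t. t powr (\<alpha> - 1) *\<^sub>R T t y) has_integral I) {0..}"
    by (rule frac_integral[OF assms])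
  have "Gamma \<alpha> > 0" using assms by (rule Gamma_real_pos)
  then show ?thesis using I unfolding frac_neg_pow_def integral_unique[OF I] by simp
qed

text \<open>Cutting the integral for \<open>(-A)\<^sup>-\<^sup>\<alpha> y\<close> at \<open>\<delta>\<close> and integrating the tail by parts bounds the
  K-functional of the pair \<open>(H, D(A))\<close>.\<close>

lemma frac_neg_pow_decomposition:
  assumes al: "0 < \<alpha>" "\<alpha> < 1"
  obtains C where "C > 0" "\<And>y \<delta>. \<delta> > 0 \<Longrightarrow> \<exists>u w. frac_neg_pow T \<alpha> y = u + gen_inv T w \<and>
    norm u \<le> C * \<delta> powr \<alpha> * norm y \<and> norm w \<le> C * \<delta> powr (\<alpha> - 1) * norm y"
proof -
  note lin0 = linear_0[OF gen_inv_linear]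
  have G: "Gamma \<alpha> > 0" using al by (simp add: Gamma_real_pos)
  \<comment> \<open>K/\<alpha> stems from the integral over [0, \<delta>], 1 from the remainder
    beyond \<delta> + r, and 3 K from the three terms of \<open>W r\<close>.\<close>
  define C where "C = (K / \<alpha> + 1 + 3 * K) / Gamma \<alpha>"
  have C: "C > 0" using G K_ge_0 al by (simp add: C_def add_nonneg_pos add_pos_nonneg)
  have scale: "norm ((1 / Gamma \<alpha>) *\<^sub>R v) \<le> C * p * q"
    if "norm v \<le> (K / \<alpha> + 1 + 3 * K) * (p * q)" for v :: 'a and p q
  proof -
    have "norm ((1 / Gamma \<alpha>) *\<^sub>R v) = norm v / Gamma \<alpha>" using G by simp
    also have "\<dots> \<le> (K / \<alpha> + 1 + 3 * K) * (p * q) / Gamma \<alpha>"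
      using G that by (intro divide_right_mono) auto
    finally show ?thesis by (simp add: C_def mult.assoc)
  qed
  have main: "\<exists>u w. frac_neg_pow T \<alpha> y = u + gen_inv T w \<and>
    norm u \<le> C * \<delta> powr \<alpha> * norm y \<and> norm w \<le> C * \<delta> powr (\<alpha> - 1) * norm y" if \<delta>: "\<delta> > 0" for y \<delta>
  \<comment> \<open>For y = 0 the tolerance \<delta>^\<alpha> |y| used to pick r would not be
    positive.\<close>
  proof (cases "y = 0")
    case True
    have "((\<lambda>t. t powr (\<alpha> - 1) *\<^sub>R T t y) has_integral 0) {0..}"
      by (rule has_integral_is_0) (simp add: True linear_0[OF T_linear])
    then have "frac_neg_pow T \<alpha> y = 0" unfolding frac_neg_pow_def by (simp add: integral_unique)
    then show ?thesis by (intro exI[of _ 0]) (simp add: lin0 True)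
  next
    case False
    obtain F I where F: "F 0 = 0" "continuous_on {0..} F"
      "\<And>t. t > 0 \<Longrightarrow> (F has_vector_derivative t powr (\<alpha> - 1) *\<^sub>R T t y) (at t)"
      "(F \<longlongrightarrow> I) at_top" "((\<lambda>t. t powr (\<alpha> - 1) *\<^sub>R T t y) has_integral I) {0..}"
      by (rule frac_integral[OF al(1), of y]) (rule that; assumption)
    have I: "frac_neg_pow T \<alpha> y = (1 / Gamma \<alpha>) *\<^sub>R I"
      unfolding frac_neg_pow_def integral_unique[OF F(5)] ..
    have F\<delta>: "norm (F \<delta>) \<le> K / \<alpha> * \<delta> powr \<alpha> * norm y"
    proof -
      define \<phi> where "\<phi> t = K * norm y * (t powr \<alpha> / \<alpha>)" for t
      have "norm (F \<delta> - F 0) \<le> \<phi> \<delta> - \<phi> 0"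
      proof (rule differentiable_bound_general[OF \<delta>])
        show "continuous_on {0..\<delta>} F" by (rule continuous_on_subset[OF F(2)]) auto
        show "continuous_on {0..\<delta>} \<phi>" unfolding \<phi>_def
          using al by (intro continuous_intros continuous_on_powr') auto
        fix t assume t: "0 < t" "t < \<delta>"
        show "(F has_vector_derivative t powr (\<alpha> - 1) *\<^sub>R T t y) (at t)" by (rule F(3)[OF t(1)])
        show "(\<phi> has_vector_derivative K * norm y * t powr (\<alpha> - 1)) (at t)"
          unfolding \<phi>_def has_real_derivative_iff_has_vector_derivative[symmetric]
          using al t by (auto intro!: derivative_eq_intros)
        have "t powr (\<alpha> - 1) * norm (T t y) \<le> t powr (\<alpha> - 1) * (K * norm y)"
          using t by (intro mult_left_mono norm_le) auto
        then show "norm (t powr (\<alpha> - 1) *\<^sub>R T t y) \<le> K * norm y * t powr (\<alpha> - 1)"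
          by (simp add: mult_ac)
      qed
      then show ?thesis using al by (simp add: \<phi>_def F(1) mult_ac)
    qed
    have "continuous_on {0..} (\<lambda>r. (\<delta> + r) powr (\<alpha> - 2) *\<^sub>R T (\<delta> + r) y)"
      using \<delta> by (intro continuous_on_scaleR continuous_on_powr continuous_on_add continuous_on_const
          continuous_on_id continuous_on_compose2[OF orbit_continuous]) auto
    then obtain H where H: "H 0 = 0" "\<And>r. r \<ge> 0 \<Longrightarrow>
        (H has_vector_derivative (\<delta> + r) powr (\<alpha> - 2) *\<^sub>R T (\<delta> + r) y) (at r within {0..})"
      by (rule hilbert_antiderivative) (rule that; assumption)
    have H_at: "(H has_vector_derivative (\<delta> + r) powr (\<alpha> - 2) *\<^sub>R T (\<delta> + r) y) (at r)" if "r > 0" for r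
      using has_vector_derivative_at_within_Ici[OF H(2)] that by simp
    have H_cont: "continuous_on {0..} H"
      unfolding continuous_on_eq_continuous_within
      using H(2) has_vector_derivative_continuous by (metis atLeast_iff)
    have powr_shift: "((\<lambda>r. (\<delta> + r) powr p) has_vector_derivative p * (\<delta> + r) powr (p - 1)) (at r)"
      if "r > 0" for r p
      unfolding has_real_derivative_iff_has_vector_derivative[symmetric]
      using \<delta> that by (auto intro!: derivative_eq_intros)
    have H_le: "(1 - \<alpha>) * norm (H r) \<le> K * norm y * \<delta> powr (\<alpha> - 1)" if r: "r > 0" for r
    proof -
      define \<phi> where "\<phi> r = - (K * norm y / (1 - \<alpha>)) * (\<delta> + r) powr (\<alpha> - 1)" for r
      have "norm (H r - H 0) \<le> \<phi> r - \<phi> 0"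
      proof (rule differentiable_bound_general[OF r])
        show "continuous_on {0..r} H" by (rule continuous_on_subset[OF H_cont]) auto
        show "continuous_on {0..r} \<phi>" unfolding \<phi>_def
          using \<delta> by (intro continuous_on_mult continuous_on_powr continuous_on_add continuous_on_const
              continuous_on_id) auto
        fix t assume t: "0 < t" "t < r"
        show "(H has_vector_derivative (\<delta> + t) powr (\<alpha> - 2) *\<^sub>R T (\<delta> + t) y) (at t)"
          by (rule H_at[OF t(1)])
        have "(\<phi> has_vector_derivative - (K * norm y / (1 - \<alpha>)) * ((\<alpha> - 1) * (\<delta> + t) powr (\<alpha> - 1 - 1))) (at t)"
          unfolding \<phi>_def
          by (intro has_vector_derivative_mult_right powr_shift t)
        moreover have "- (k / (1 - \<alpha>)) * ((\<alpha> - 1) * q) = k * q" for k q :: real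
          using al by (simp add: divide_simps) (simp add: algebra_simps)
        ultimately show "(\<phi> has_vector_derivative K * norm y * (\<delta> + t) powr (\<alpha> - 2)) (at t)" by simp
        have "(\<delta> + t) powr (\<alpha> - 2) * norm (T (\<delta> + t) y) \<le> (\<delta> + t) powr (\<alpha> - 2) * (K * norm y)"
          using t \<delta> by (intro mult_left_mono norm_le) auto
        then show "norm ((\<delta> + t) powr (\<alpha> - 2) *\<^sub>R T (\<delta> + t) y) \<le> K * norm y * (\<delta> + t) powr (\<alpha> - 2)"
          by (simp add: mult_ac)
      qed
      also have "\<dots> \<le> - \<phi> 0" using K_ge_0 al by (simp add: \<phi>_def)
      finally have "norm (H r) \<le> K * norm y / (1 - \<alpha>) * \<delta> powr (\<alpha> - 1)" by (simp add: \<phi>_def H(1))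
      then show ?thesis using al by (simp add: field_simps)
    qed
    \<comment> \<open>Integration by parts with T(t) y as the derivative of T(t) A^-1 y: boundary
      terms and the integral of t^(\<alpha> - 2) T(t) y, with A^-1 pulled out in front.\<close>
    define W where "W r = (\<delta> + r) powr (\<alpha> - 1) *\<^sub>R T (\<delta> + r) y - \<delta> powr (\<alpha> - 1) *\<^sub>R T \<delta> y
      + (1 - \<alpha>) *\<^sub>R H r" for r
    have gi_bl: "bounded_linear (gen_inv T)"
      by (rule gen_inv_bounded) (rule bounded_linear_if_norm_le[OF gen_inv_linear])
    have parts: "F (\<delta> + r) = F \<delta> + gen_inv T (W r)" if r: "r \<ge> 0" for r
    proof -
      define D where "D r = F (\<delta> + r) - (\<delta> + r) powr (\<alpha> - 1) *\<^sub>R T (\<delta> + r) (gen_inv T y)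
        - (1 - \<alpha>) *\<^sub>R gen_inv T (H r)" for r
      have "D r = D 0"
      proof (rule vector_derivative_zero_const[OF r])
        show "continuous_on {0..r} D"
          unfolding D_def using \<delta>
          by (intro continuous_on_diff continuous_on_scaleR continuous_on_powr continuous_on_add
              continuous_on_const continuous_on_id continuous_on_compose2[OF orbit_continuous]
              continuous_on_compose2[OF F(2)] bounded_linear.continuous_on[OF gi_bl]
              continuous_on_subset[OF H_cont]) auto
        fix t assume t: "0 < t" "t < r"
        define p where "p = \<delta> + t"
        have p: "p > 0" using \<delta> t by (simp add: p_def)
        have shift: "((\<lambda>r. \<delta> + r) has_vector_derivative 1) (at t)"
          by (auto intro!: derivative_eq_intros)
        have 1: "((\<lambda>r. F (\<delta> + r)) has_vector_derivative p powr (\<alpha> - 1) *\<^sub>R T p y) (at t)"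
          using vector_diff_chain_at[OF shift F(3)[OF p, unfolded p_def]] by (simp add: o_def p_def)
        have 2: "((\<lambda>r. T (\<delta> + r) (gen_inv T y)) has_vector_derivative T p y) (at t)"
          using vector_diff_chain_at[OF shift gen_inv_orbit_derivative_at[OF p, unfolded p_def]]
          by (simp add: o_def p_def)
        have 3: "((\<lambda>r. (\<delta> + r) powr (\<alpha> - 1) *\<^sub>R T (\<delta> + r) (gen_inv T y)) has_vector_derivative
            p powr (\<alpha> - 1) *\<^sub>R T p y + ((\<alpha> - 1) * p powr (\<alpha> - 2)) *\<^sub>R T p (gen_inv T y)) (at t)"
          using has_vector_derivative_scaleR[OF powr_shift[OF t(1), of "\<alpha> - 1",
              folded has_real_derivative_iff_has_vector_derivative] 2]
          by (simp add: p_def)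
        have 4: "((\<lambda>r. gen_inv T (H r)) has_vector_derivative gen_inv T (p powr (\<alpha> - 2) *\<^sub>R T p y)) (at t)"
          by (rule bounded_linear.has_vector_derivative[OF gi_bl H_at[OF t(1), folded p_def]])
        have 5: "gen_inv T (p powr (\<alpha> - 2) *\<^sub>R T p y) = p powr (\<alpha> - 2) *\<^sub>R T p (gen_inv T y)"
          using p by (simp add: linear_scale[OF gen_inv_linear] gen_inv_commute)
        have 6: "((\<lambda>r. (1 - \<alpha>) *\<^sub>R gen_inv T (H r)) has_vector_derivative
            ((1 - \<alpha>) * p powr (\<alpha> - 2)) *\<^sub>R T p (gen_inv T y)) (at t)"
          using bounded_linear.has_vector_derivative[OF bounded_linear_scaleR_right 4, of "1 - \<alpha>"]
          unfolding 5 by simp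
        show "(D has_vector_derivative 0) (at t)"
          unfolding D_def
          using has_vector_derivative_diff[OF has_vector_derivative_diff[OF 1 3] 6]
          by (simp add: algebra_simps)
      qed
      then have "F (\<delta> + r) - F \<delta> = (\<delta> + r) powr (\<alpha> - 1) *\<^sub>R T (\<delta> + r) (gen_inv T y)
          - \<delta> powr (\<alpha> - 1) *\<^sub>R T \<delta> (gen_inv T y) + (1 - \<alpha>) *\<^sub>R gen_inv T (H r)"
        by (simp add: D_def H(1) lin0 algebra_simps)
      also have "\<dots> = gen_inv T (W r)"
        using \<delta> r by (simp add: W_def linear_add[OF gen_inv_linear] linear_diff[OF gen_inv_linear]
            linear_scale[OF gen_inv_linear] gen_inv_commute)
      finally show ?thesis by (simp add: algebra_simps)
    qed
    \<comment> \<open>A finite r is fixed and the remainder is put into u, which replaces the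
      passage to the limit in W.\<close>
    have "((\<lambda>r. F (\<delta> + r)) \<longlongrightarrow> I) at_top"
      by (rule filterlim_compose[OF F(4) filterlim_tendsto_add_at_top[OF tendsto_const filterlim_ident]])
    moreover have "\<delta> powr \<alpha> * norm y > 0" using \<delta> False by simp
    ultimately have "\<forall>\<^sub>F r in at_top. dist (F (\<delta> + r)) I < \<delta> powr \<alpha> * norm y" by (rule tendstoD)
    then have "\<forall>\<^sub>F r in at_top. dist (F (\<delta> + r)) I < \<delta> powr \<alpha> * norm y \<and> r > 0"
      by (rule eventually_conj[OF _ eventually_gt_at_top])
    then obtain r where r: "norm (I - F (\<delta> + r)) \<le> \<delta> powr \<alpha> * norm y" "r > 0"
      using eventually_happens'[OF trivial_limit_at_top_linorder]
      by (force simp: dist_norm norm_minus_commute)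
    define u w where "u = (1 / Gamma \<alpha>) *\<^sub>R (F \<delta> + (I - F (\<delta> + r)))" and "w = (1 / Gamma \<alpha>) *\<^sub>R W r"
    have "frac_neg_pow T \<alpha> y = u + gen_inv T w"
      using r parts[of r]
      by (simp add: I u_def w_def linear_scale[OF gen_inv_linear] flip: scaleR_add_right)
    moreover have "norm u \<le> C * \<delta> powr \<alpha> * norm y"
    proof -
      have "norm (F \<delta> + (I - F (\<delta> + r))) \<le> K / \<alpha> * \<delta> powr \<alpha> * norm y + \<delta> powr \<alpha> * norm y"
        using norm_triangle_ineq[of "F \<delta>" "I - F (\<delta> + r)"] F\<delta> r(1) by linarith
      also have "\<dots> = (K / \<alpha> + 1) * (\<delta> powr \<alpha> * norm y)" by (simp add: distrib_right)
      also have "\<dots> \<le> (K / \<alpha> + 1 + 3 * K) * (\<delta> powr \<alpha> * norm y)"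
        using K_ge_0 by (intro mult_right_mono) auto
      finally show ?thesis unfolding u_def by (rule scale)
    qed
    moreover have "norm w \<le> C * \<delta> powr (\<alpha> - 1) * norm y"
    proof -
      have T_part: "norm (p powr (\<alpha> - 1) *\<^sub>R T p y) \<le> K * norm y * \<delta> powr (\<alpha> - 1)" if "p \<ge> \<delta>" for p
      proof -
        have "norm (p powr (\<alpha> - 1) *\<^sub>R T p y) \<le> \<delta> powr (\<alpha> - 1) * (K * norm y)"
          unfolding norm_scaleR
          using that \<delta> al by (intro mult_mono norm_le) (auto intro: powr_mono2')
        then show ?thesis by (simp add: mult_ac)
      qed
      have "norm (W r) \<le> norm ((\<delta> + r) powr (\<alpha> - 1) *\<^sub>R T (\<delta> + r) y)
          + norm (\<delta> powr (\<alpha> - 1) *\<^sub>R T \<delta> y) + norm ((1 - \<alpha>) *\<^sub>R H r)"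
        unfolding W_def by (intro norm_triangle_mono norm_triangle_ineq4 order_refl)
      also have "\<dots> \<le> K * norm y * \<delta> powr (\<alpha> - 1) + K * norm y * \<delta> powr (\<alpha> - 1) + K * norm y * \<delta> powr (\<alpha> - 1)"
        using T_part[of "\<delta> + r"] T_part[of \<delta>] H_le[OF r(2)] r(2) al by (intro add_mono) auto
      also have "\<dots> = 3 * K * (\<delta> powr (\<alpha> - 1) * norm y)" by (simp add: mult_ac)
      also have "\<dots> \<le> (K / \<alpha> + 1 + 3 * K) * (\<delta> powr (\<alpha> - 1) * norm y)"
        using K_ge_0 al by (intro mult_right_mono) auto
      finally show ?thesis unfolding w_def by (rule scale)
    qed
    ultimately show ?thesis by blast
  qed
  show thesis by (rule that[OF C main])
qed

end

section \<open>Injectivity of the negative fractional powers\<close>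

lemma integrable_powr_exp:
  fixes a w :: real
  assumes a: "a > 0" and w: "w > 0"
  shows "integrable lborel (\<lambda>t. if 0 < t then t powr (a - 1) * exp (- w * t) else 0)"
proof -
  have "(\<lambda>t. norm (complex_of_real t powr (complex_of_real a - 1) / of_real (exp (w * t))))
      absolutely_integrable_on {0<..}"
    using absolutely_integrable_Gamma_integral[of "complex_of_real a" w] assms
    by (intro set_integrable_norm) simp
  then have "integrable lebesgue (\<lambda>t. indicator {0<..} t *\<^sub>R
      norm (complex_of_real t powr (complex_of_real a - 1) / of_real (exp (w * t))))"
    by (simp add: set_integrable_def)
  moreover have "indicator {0<..} t *\<^sub>R norm (complex_of_real t powr (complex_of_real a - 1) / of_real (exp (w * t)))
      = (if 0 < t then t powr (a - 1) * exp (- w * t) else 0)" for t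
    using norm_powr_real_powr[of "complex_of_real t" "complex_of_real a - 1"]
    by (simp add: norm_divide exp_minus field_simps)
  ultimately have "integrable lebesgue (\<lambda>t. if 0 < t then t powr (a - 1) * exp (- w * t) else 0)"
    by simp
  then show ?thesis by (subst (asm) integrable_completion) auto
qed

lemma Beta_lborel:
  fixes a b :: real
  assumes "a > 0" "b > 0"
  defines "k \<equiv> \<lambda>u. if 0 < u \<and> u < 1 then u powr (a - 1) * (1 - u) powr (b - 1) else 0"
  shows "integrable lborel k" "integral\<^sup>L lborel k = Beta a b"
proof -
  have eq: "indicator {0..1} u *\<^sub>R (u powr (a - 1) * (1 - u) powr (b - 1)) = k u" for u
    by (cases "u = 0"; cases "u = 1") (auto simp: k_def indicator_def)
  have int: "set_integrable lborel {0..1} (\<lambda>t. t powr (a - 1) * (1 - t) powr (b - 1))"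
    by (rule integrable_Beta[OF assms(1,2)])
  then show "integrable lborel k" by (simp only: set_integrable_def eq)
  show "integral\<^sup>L lborel k = Beta a b"
    using set_borel_integral_eq_integral(2)[OF int] integral_unique[OF has_integral_Beta_real[OF assms(1,2)]]
    by (simp only: set_lebesgue_integral_def eq)
qed

text \<open>Abel inversion: integrating the hypothesis against \<open>s\<^sup>-\<^sup>\<alpha>\<close> and exchanging the integrals
  replaces the kernel by the constant \<open>B(1 - \<alpha>, \<alpha>)\<close>.\<close>

lemma abel_transform_eq_0:
  fixes f :: "real \<Rightarrow> real"
  assumes cont: "continuous_on {0..} f" and f_le: "\<And>t. t \<ge> 0 \<Longrightarrow> \<bar>f t\<bar> \<le> D * exp (- w * t)"
    and w: "w > 0" and al: "0 < \<alpha>" "\<alpha> < 1"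
    and zero: "\<And>s. s \<ge> 0 \<Longrightarrow> ((\<lambda>t. t powr (\<alpha> - 1) * f (t + s)) has_integral 0) {0..}"
  shows "(f has_integral 0) {0..}"
proof -
  \<comment> \<open>A continuous extension to the whole line, so that measurability is
    immediate.\<close>
  define g where "g t = f (max 0 t)" for t
  have g: "g t = f t" if "t \<ge> 0" for t using that by (simp add: g_def)
  have "continuous_on UNIV g" unfolding g_def
    by (intro continuous_on_compose2[OF cont] continuous_intros) auto
  then have [measurable]: "g \<in> borel_measurable borel" by (rule borel_measurable_continuous_onI)
  have D: "D \<ge> 0" using order_trans[OF abs_ge_zero f_le[of 0]] by simp
  define \<beta> where "\<beta> = Beta (1 - \<alpha>) \<alpha>"
  have \<beta>: "\<beta> > 0" using al by (simp add: \<beta>_def Beta_def Gamma_real_pos)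
  define k where "k u = (if 0 < u \<and> u < 1 then u powr (- \<alpha>) * (1 - u) powr (\<alpha> - 1) else 0)" for u :: real
  have exponent: "1 - \<alpha> - 1 = - \<alpha>" by simp
  have k: "integrable lborel k" "integral\<^sup>L lborel k = \<beta>"
    using Beta_lborel[of "1 - \<alpha>" \<alpha>, unfolded exponent] al by (auto simp: k_def[abs_def] \<beta>_def)
  \<comment> \<open>The Abel kernel. The substitution s = t u turns its s-integral into the Beta
    constant times g t, while its t-integral is s^(-\<alpha>) times the shifted integral of the
    hypothesis.\<close>
  define h where "h t s = (if 0 < s \<and> s < t then s powr (- \<alpha>) * (t - s) powr (\<alpha> - 1) * g t else 0)" for t s
  have h_eq: "h t s = g t * (1 / t) * k (0 + (1 / t) * s)" if t: "t > 0" for t s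
  proof (cases "0 < s \<and> s < t")
    case True
    have "(s / t) powr (- \<alpha>) = s powr (- \<alpha>) * t powr \<alpha>"
      using True t by (simp add: powr_divide powr_minus divide_simps)
    moreover have "1 - s / t = (t - s) / t" using t by (simp add: field_simps)
    then have "(1 - s / t) powr (\<alpha> - 1) = (t - s) powr (\<alpha> - 1) * t powr (1 - \<alpha>)"
      using True t by (simp add: powr_divide powr_diff divide_simps)
    moreover have "t powr \<alpha> * t powr (1 - \<alpha>) = t" using t by (simp flip: powr_add)
    ultimately show ?thesis using True t by (simp add: h_def k_def field_simps)
  qed (use t in \<open>auto simp: h_def k_def field_simps\<close>)
  have h_int: "integrable lborel (h t)" "(\<integral>s. h t s \<partial>lborel) = (if 0 < t then \<beta> * g t else 0)"
    "(\<integral>s. norm (h t s) \<partial>lborel) = (if 0 < t then \<beta> * \<bar>g t\<bar> else 0)" for t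
  proof -
    consider "t > 0" | "t \<le> 0" by linarith
    then have "integrable lborel (h t) \<and> (\<integral>s. h t s \<partial>lborel) = (if 0 < t then \<beta> * g t else 0) \<and>
      (\<integral>s. norm (h t s) \<partial>lborel) = (if 0 < t then \<beta> * \<bar>g t\<bar> else 0)"
    proof cases
      case 1
      have "integrable lborel (\<lambda>s. k (0 + (1 / t) * s))"
        using 1 k(1) by (intro lborel_integrable_real_affine) auto
      moreover have "(\<integral>s. k (0 + (1 / t) * s) \<partial>lborel) = t * \<beta>"
        using lborel_integral_real_affine[of "1 / t" k 0] 1 k(2) by (simp add: field_simps)
      moreover have "\<bar>k (0 + (1 / t) * s)\<bar> = k (0 + (1 / t) * s)" for s by (simp add: k_def)
      ultimately show ?thesis using 1 unfolding h_eq[OF 1, abs_def] real_norm_def abs_mult by simp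
    next
      case 2
      then have "h t = (\<lambda>s. 0)" by (auto simp: h_def fun_eq_iff)
      then show ?thesis using 2 by simp
    qed
    then show "integrable lborel (h t)" "(\<integral>s. h t s \<partial>lborel) = (if 0 < t then \<beta> * g t else 0)"
      "(\<integral>s. norm (h t s) \<partial>lborel) = (if 0 < t then \<beta> * \<bar>g t\<bar> else 0)" by auto
  qed
  have E: "integrable lborel (\<lambda>t. D * (if 0 < t then t powr (1 - 1) * exp (- w * t) else 0))"
    using integrable_powr_exp[of 1 w] w by (intro integrable_mult_right) auto
  have g_int: "integrable lborel (\<lambda>t. if 0 < t then g t else 0)"
    by (rule Bochner_Integration.integrable_bound[OF E]) (use f_le g D in auto)
  have "integrable (lborel \<Otimes>\<^sub>M lborel) (case_prod h)"
  proof (rule lborel_pair.Fubini_integrable)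
    show "case_prod h \<in> borel_measurable (lborel \<Otimes>\<^sub>M lborel)"
      unfolding h_def[abs_def] by measurable
    have "integrable lborel (\<lambda>t. \<beta> * \<bar>if 0 < t then g t else 0\<bar>)"
      using g_int by (intro integrable_mult_right integrable_abs)
    moreover have "\<beta> * \<bar>if 0 < t then g t else 0\<bar> = (\<integral>s. norm (case_prod h (t, s)) \<partial>lborel)" for t
      unfolding prod.case h_int(3) by simp
    ultimately show "integrable lborel (\<lambda>t. \<integral>s. norm (case_prod h (t, s)) \<partial>lborel)" by simp
    show "AE t in lborel. integrable lborel (\<lambda>s. case_prod h (t, s))" using h_int(1) by simp
  qed
  note fubini = lborel_pair.Fubini_integral[OF this]
  \<comment> \<open>After the shift t -> t + s this is the hypothesis \<open>zero\<close>;
    \<open>m\<close> is the shifted integrand.\<close>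
  have "(\<integral>t. h t s \<partial>lborel) = 0" for s
  proof (cases "s > 0")
    case True
    define m where "m t = (if 0 < t then t powr (\<alpha> - 1) * g (t + s) else 0)" for t
    have "integrable lborel (\<lambda>t. D * (if 0 < t then t powr (\<alpha> - 1) * exp (- w * t) else 0))"
      using integrable_powr_exp[OF al(1) w] by (intro integrable_mult_right)
    then have m: "integrable lborel m"
    proof (rule Bochner_Integration.integrable_bound)
      show "m \<in> borel_measurable lborel" unfolding m_def[abs_def] by measurable
      have "norm (m t) \<le> norm (D * (if 0 < t then t powr (\<alpha> - 1) * exp (- w * t) else 0))" for t
      proof (cases "t > 0")
        case t: True
        have "\<bar>g (t + s)\<bar> \<le> D * exp (- w * (t + s))" using t True f_le g by simp
        also have "\<dots> \<le> D * exp (- w * t)" using D w t True by (intro mult_left_mono) auto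
        finally have "t powr (\<alpha> - 1) * \<bar>g (t + s)\<bar> \<le> t powr (\<alpha> - 1) * (D * exp (- w * t))"
          by (intro mult_left_mono) auto
        then show ?thesis using t D by (simp add: m_def abs_mult mult_ac)
      qed (simp add: m_def)
      then show "AE t in lborel. norm (m t) \<le> norm (D * (if 0 < t then t powr (\<alpha> - 1) * exp (- w * t) else 0))"
        by simp
    qed
    have "((\<lambda>t. if t \<in> {0..} then t powr (\<alpha> - 1) * f (t + s) else 0) has_integral 0) UNIV"
      using zero[of s] True by (simp only: has_integral_restrict_UNIV)
    then have "(m has_integral 0) UNIV"
      by (rule has_integral_eq[rotated]) (use True in \<open>auto simp: m_def g\<close>)
    then have "integral\<^sup>L lborel m = 0"
      using has_integral_integral_lborel[OF m] has_integral_unique by blast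
    then have "(\<integral>t. m (- s + 1 * t) \<partial>lborel) = 0"
      using lborel_integral_real_affine[of 1 m "- s"] by simp
    moreover have "h t s = s powr (- \<alpha>) * m (- s + 1 * t)" for t
      using True by (auto simp: h_def m_def)
    ultimately show ?thesis by simp
  next
    case False
    then have "(\<lambda>t. h t s) = (\<lambda>t. 0)" by (auto simp: h_def fun_eq_iff)
    then show ?thesis by simp
  qed
  then have "(\<integral>t. (if 0 < t then \<beta> * g t else 0) \<partial>lborel) = 0"
    using fubini unfolding h_int(2) by simp
  moreover have "(if 0 < t then \<beta> * g t else 0) = \<beta> * (if 0 < t then g t else 0)" for t by simp
  ultimately have "(\<integral>t. (if 0 < t then g t else 0) \<partial>lborel) = 0" using \<beta> by simp
  then have "((\<lambda>t. if 0 < t then g t else 0) has_integral 0) UNIV"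
    using has_integral_integral_lborel[OF g_int] by simp
  then have "((\<lambda>t. if t \<in> {0..} then f t else 0) has_integral 0) UNIV"
    by (rule has_integral_spike[OF negligible_sing[of 0], rotated]) (auto simp: g)
  then show ?thesis by (simp only: has_integral_restrict_UNIV)
qed

context stable_C0_semigroup
begin

text \<open>Applying T(s) to the vanishing integral yields all its shifts, which is the hypothesis
  of the Abel inversion for t -> <T(t) y, v>. The outcome is <A^-1 y, v> = 0 for every v.\<close>

lemma frac_neg_pow_eq_0:
  assumes al: "0 < \<alpha>" "\<alpha> < 1" and y: "frac_neg_pow T \<alpha> y = 0"
  shows "y = 0"
proof -
  have 0: "((\<lambda>t. t powr (\<alpha> - 1) *\<^sub>R T t y) has_integral 0) {0..}"
    using frac_neg_pow_has_integral[OF al(1), of y] y by simp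
  have "inner (gen_inv T y) v = 0" for v
  proof -
    have "((\<lambda>t. inner (T t y) v) has_integral 0) {0..}"
    proof (rule abel_transform_eq_0[OF _ _ om al])
      show "continuous_on {0..} (\<lambda>t. inner (T t y) v)"
        by (intro continuous_intros orbit_continuous)
      show "\<bar>inner (T t y) v\<bar> \<le> (K * norm y * norm v) * exp (- \<omega> * t)" if "t \<ge> 0" for t
      proof -
        have "\<bar>inner (T t y) v\<bar> \<le> norm (T t y) * norm v" by (rule Cauchy_Schwarz_ineq2)
        also have "\<dots> \<le> (K * exp (- \<omega> * t) * norm y) * norm v"
          using norm_exp[OF that] by (intro mult_right_mono) auto
        finally show ?thesis by (simp add: mult_ac)
      qed
      show "((\<lambda>t. t powr (\<alpha> - 1) * inner (T (t + s) y) v) has_integral 0) {0..}" if s: "s \<ge> 0" for s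
      proof -
        have "bounded_linear (\<lambda>x. inner (T s x) v)"
          by (rule bounded_linear_compose[OF bounded_linear_inner_left bl[OF s]])
        from has_integral_linear[OF 0 this]
        have "((\<lambda>t. inner (T s (t powr (\<alpha> - 1) *\<^sub>R T t y)) v) has_integral 0) {0..}"
          by (simp add: o_def linear_0[OF T_linear[OF s]])
        then show ?thesis
          by (rule has_integral_eq[rotated])
            (use s in \<open>simp add: linear_scale[OF T_linear] T_add add.commute[of _ s]\<close>)
      qed
    qed
    moreover have "((\<lambda>t. inner (T t y) v) has_integral inner (- gen_inv T y) v) {0..}"
      using has_integral_linear[OF orbit_has_integral bounded_linear_inner_left] by (simp add: o_def)
    ultimately have "inner (- gen_inv T y) v = 0" using has_integral_unique by blast
    then show ?thesis by simp
  qed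
  from this[of "gen_inv T y"] show ?thesis using gen_inv_eq_0 by simp
qed

text \<open>This gives the definite description in \<open>frac_pow\<close> its intended
  value.\<close>

lemma frac_neg_pow_inj:
  assumes al: "0 < \<alpha>" "\<alpha> < 1" and eq: "frac_neg_pow T \<alpha> y = frac_neg_pow T \<alpha> z"
  shows "y = z"
proof -
  have "((\<lambda>t. t powr (\<alpha> - 1) *\<^sub>R T t y - t powr (\<alpha> - 1) *\<^sub>R T t z) has_integral 0) {0..}"
    using has_integral_diff[OF frac_neg_pow_has_integral[OF al(1), of y]
        frac_neg_pow_has_integral[OF al(1), of z]] eq by simp
  then have "((\<lambda>t. t powr (\<alpha> - 1) *\<^sub>R T t (y - z)) has_integral 0) {0..}"
    by (rule has_integral_eq[rotated]) (simp add: linear_diff[OF T_linear] scaleR_diff_right)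
  then have "frac_neg_pow T \<alpha> (y - z) = 0" by (simp add: frac_neg_pow_def integral_unique)
  then have "y - z = 0" by (rule frac_neg_pow_eq_0[OF al])
  then show ?thesis by simp
qed

lemma frac_pow_frac_neg_pow:
  assumes "0 < \<alpha>" "\<alpha> < 1"
  shows "frac_pow T \<alpha> (frac_neg_pow T \<alpha> y) = y"
  unfolding frac_pow_def using frac_neg_pow_inj[OF assms] by blast

end

section \<open>The Crank--Nicolson scheme\<close>

locale crank_nicolson = stable_C0_semigroup T K \<omega> + S: bounded_C0_semigroup S M
  for T S :: "real \<Rightarrow> 'a::{real_inner, complete_space} \<Rightarrow> 'a" and K \<omega> M :: real +
  fixes b :: real
  assumes K_pos: "K > 0" and M_pos: "M > 0" and b_pos: "b > 0"
    and gen_inv_le: "norm (gen_inv T x) \<le> b * norm x"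
    and S_dom: "gen_dom S = UNIV" and S_gen: "gen S x = gen_inv T x"
begin

sublocale cn: cayley_adjoint_pair T S "gen_inv T" K \<omega> M b
proof (rule cayley_adjoint_pair.intro, rule cayley_pair.intro)
  show "cayley_adjoint_pair_axioms T S (gen_inv T)"
  proof
    show "T t (gen_inv T x) = gen_inv T (T t x)" if "t \<ge> 0" for t x by (rule gen_inv_commute[OF that])
    show "S t (gen_inv T x) = gen_inv T (S t x)" if "t \<ge> 0" for t x
      using S.gen_semigroup_commute(2)[of x t] that by (simp add: S_dom S_gen)
  qed (rule gen_inv_eq_0)
  show "((\<lambda>t. S t x) has_vector_derivative S t (gen_inv T x)) (at t within {0..})" if "t \<ge> 0" for t x
    using S.orbit_derivative[of x t] that by (simp add: S_dom S_gen)
  show "((\<lambda>t. T t (gen_inv T x)) has_vector_derivative T t x) (at t within {0..})" if "t \<ge> 0" for t x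
    by (rule gen_inv_orbit_derivative[OF that])
  show "norm (T t x) \<le> K * exp (- \<omega> * t) * norm x" if "t \<ge> 0" for t x
    by (rule norm_exp[OF that])
qed (use K_pos M_pos b_pos om gen_inv_le in
    \<open>simp_all add: T_linear S.T_linear gen_inv_linear T_0 S.T_0 S.norm_le orbit_continuous
      S.orbit_continuous\<close>)

text \<open>With z = A^-1 w one has A z = w, so w parametrises the solutions of the implicit
  equation; injectivity of B - s pins the described z down.\<close>

lemma cayley_eq:
  assumes "\<tau> > 0"
  shows "cayley T \<tau> (gen_inv T w - (\<tau> / 2) *\<^sub>R w) = gen_inv T w + (\<tau> / 2) *\<^sub>R w"
proof -
  have "(THE z. z \<in> gen_dom T \<and> z - (\<tau> / 2) *\<^sub>R gen T z = gen_inv T w - (\<tau> / 2) *\<^sub>R w) = gen_inv T w"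
  proof (rule the_equality)
    show "gen_inv T w \<in> gen_dom T \<and>
        gen_inv T w - (\<tau> / 2) *\<^sub>R gen T (gen_inv T w) = gen_inv T w - (\<tau> / 2) *\<^sub>R w"
      by (simp add: gen_inv_dom gen_gen_inv)
    fix z assume z: "z \<in> gen_dom T \<and> z - (\<tau> / 2) *\<^sub>R gen T z = gen_inv T w - (\<tau> / 2) *\<^sub>R w"
    then have "gen_inv T (gen T z - w) - (\<tau> / 2) *\<^sub>R (gen T z - w) = 0"
      by (simp add: linear_diff[OF gen_inv_linear] gen_inv_gen algebra_simps)
    then have "gen T z - w = 0" by (rule cn.B_minus_inj[rotated]) (use assms in simp)
    then show "z = gen_inv T w" using z gen_inv_gen[of z] by simp
  qed
  then show ?thesis by (simp add: cayley_def Let_def gen_gen_inv)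
qed

lemma cayley_recursion_orbit:
  assumes \<tau>: "\<And>n. \<tau> n > 0" and x: "\<And>n. x (Suc n) = cayley T (\<tau> n) (x n)"
  obtains w where "cn.cayley_orbit (\<lambda>n. \<tau> n / 2) w x"
proof -
  have "\<exists>w. gen_inv T w - (\<tau> n / 2) *\<^sub>R w = x n" for n
    using surjD[OF cn.B_minus_surj[of "\<tau> n / 2"], of "x n"] \<tau>[of n] by (metis half_gt_zero)
  then obtain w where w: "\<And>n. gen_inv T (w n) - (\<tau> n / 2) *\<^sub>R w n = x n" by metis
  have "x (Suc n) = gen_inv T (w n) + (\<tau> n / 2) *\<^sub>R w n" for n
    unfolding x by (subst w[symmetric]) (rule cayley_eq[OF \<tau>])
  then have "cn.cayley_orbit (\<lambda>n. \<tau> n / 2) w x" by (simp add: cn.cayley_orbit_def w)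
  then show thesis by (rule that)
qed

lemma decay_gen_dom:
  assumes c: "c > 0" and \<tau>: "\<And>n. c \<le> \<tau> n" "\<And>n. \<tau> n \<le> d"
  obtains C where "C > 0" "\<And>x n. x 0 \<in> gen_dom T \<Longrightarrow> \<forall>n. x (Suc n) = cayley T (\<tau> n) (x n) \<Longrightarrow> n \<ge> 1 \<Longrightarrow>
    norm (x n) \<le> C * (1 / sqrt (real n)) * norm (gen T (x 0))"
proof -
  obtain C where C: "C > 0" "\<And>s w x y N. \<forall>k. c / 2 \<le> s k \<and> s k \<le> d / 2 \<Longrightarrow> cn.cayley_orbit s w x \<Longrightarrow>
    x 0 = gen_inv T y \<Longrightarrow> real (Suc N) * (norm (x N))\<^sup>2 \<le> C * (norm y)\<^sup>2"
    by (rule cn.orbit_decay[OF half_gt_zero[OF c], of "d / 2"]) (rule that; assumption)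
  have \<tau>_pos: "\<tau> n > 0" for n using c \<tau>(1) by (rule less_le_trans)
  have main: "norm (x n) \<le> sqrt C * (1 / sqrt (real n)) * norm (gen T (x 0))"
    if x0: "x 0 \<in> gen_dom T" and x: "\<forall>n. x (Suc n) = cayley T (\<tau> n) (x n)" and n: "n \<ge> 1" for x n
  proof -
    obtain w where w: "cn.cayley_orbit (\<lambda>n. \<tau> n / 2) w x"
      by (rule cayley_recursion_orbit[OF \<tau>_pos]) (use x in auto)
    have "real n * (norm (x n))\<^sup>2 \<le> real (Suc n) * (norm (x n))\<^sup>2" by (intro mult_right_mono) auto
    also have "\<dots> \<le> C * (norm (gen T (x 0)))\<^sup>2"
      by (rule C(2)[OF _ w]) (use \<tau> x0 gen_inv_gen in auto)
    finally have "(norm (x n))\<^sup>2 \<le> C * (norm (gen T (x 0)))\<^sup>2 / real n"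
      using n by (simp add: pos_le_divide_eq mult.commute)
    also have "\<dots> = (sqrt C * (1 / sqrt (real n)) * norm (gen T (x 0)))\<^sup>2"
      using C(1) by (simp add: power_mult_distrib power_divide)
    finally show ?thesis by (rule power2_le_imp_le) (use C(1) in simp)
  qed
  show thesis
  proof (rule that)
    show "sqrt C > 0" using C(1) by simp
  qed (rule main; assumption)
qed

lemma stability:
  assumes c: "c > 0" and \<tau>: "\<And>n. c \<le> \<tau> n" "\<And>n. \<tau> n \<le> d"
  obtains C where "C > 0" "\<And>x n. \<forall>n. x (Suc n) = cayley T (\<tau> n) (x n) \<Longrightarrow> norm (x n) \<le> C * norm (x 0)"
proof -
  obtain C where C: "C > 0" "\<And>s w x N. \<forall>k. c / 2 \<le> s k \<and> s k \<le> d / 2 \<Longrightarrow> cn.cayley_orbit s w x \<Longrightarrow>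
    (norm (x N))\<^sup>2 \<le> C * (norm (x 0))\<^sup>2"
    by (rule cn.orbit_bounded[OF half_gt_zero[OF c], of "d / 2"]) (rule that; assumption)
  have \<tau>_pos: "\<tau> n > 0" for n using c \<tau>(1) by (rule less_le_trans)
  have main: "norm (x n) \<le> sqrt C * norm (x 0)"
    if x: "\<forall>n. x (Suc n) = cayley T (\<tau> n) (x n)" for x n
  proof -
    obtain w where w: "cn.cayley_orbit (\<lambda>n. \<tau> n / 2) w x"
      by (rule cayley_recursion_orbit[OF \<tau>_pos]) (use x in auto)
    have "(norm (x n))\<^sup>2 \<le> C * (norm (x 0))\<^sup>2"
      by (rule C(2)[OF _ w]) (use \<tau> in auto)
    also have "\<dots> = (sqrt C * norm (x 0))\<^sup>2" using C(1) by (simp add: power_mult_distrib)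
    finally show ?thesis by (rule power2_le_imp_le) (use C(1) in simp)
  qed
  show thesis
  proof (rule that)
    show "sqrt C > 0" using C(1) by simp
  qed (rule main; assumption)
qed

lemma cayley_add:
  assumes "\<tau> > 0"
  shows "cayley T \<tau> (x + y) = cayley T \<tau> x + cayley T \<tau> y"
proof -
  note surj = cn.B_minus_surj[of "\<tau> / 2"]
  obtain v where v: "x = gen_inv T v - (\<tau> / 2) *\<^sub>R v" using surjD[OF surj] assms by (metis half_gt_zero)
  obtain w where w: "y = gen_inv T w - (\<tau> / 2) *\<^sub>R w" using surjD[OF surj] assms by (metis half_gt_zero)
  have "x + y = gen_inv T (v + w) - (\<tau> / 2) *\<^sub>R (v + w)"
    by (simp add: v w linear_add[OF gen_inv_linear] algebra_simps)
  then have "cayley T \<tau> (x + y) = gen_inv T (v + w) + (\<tau> / 2) *\<^sub>R (v + w)"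
    using cayley_eq[OF assms] by simp
  also have "\<dots> = cayley T \<tau> x + cayley T \<tau> y"
    unfolding v w cayley_eq[OF assms] by (simp add: linear_add[OF gen_inv_linear] algebra_simps)
  finally show ?thesis .
qed

text \<open>Real interpolation by hand: the part of the initial value in H is only kept bounded, the
  part in D(A) decays like n^(-1/2), and linearity of the scheme adds the two trajectories.\<close>

lemma decay_frac_dom:
  assumes c: "c > 0" and \<tau>: "\<And>n. c \<le> \<tau> n" "\<And>n. \<tau> n \<le> d" and al: "0 < \<alpha>" "\<alpha> < 1"
  obtains C where "C > 0" "\<And>x n. x 0 \<in> frac_dom T \<alpha> \<Longrightarrow> \<forall>n. x (Suc n) = cayley T (\<tau> n) (x n) \<Longrightarrow> n \<ge> 1 \<Longrightarrow>
    norm (x n) \<le> C * real n powr (- \<alpha> / 2) * norm (frac_pow T \<alpha> (x 0))"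
proof -
  have \<tau>_pos: "\<tau> n > 0" for n using c \<tau>(1) by (rule less_le_trans)
  obtain C1 where C1: "C1 > 0" "\<And>x n. \<forall>n. x (Suc n) = cayley T (\<tau> n) (x n) \<Longrightarrow> norm (x n) \<le> C1 * norm (x 0)"
    by (rule stability[OF c \<tau>]) (rule that; assumption)
  obtain C2 where C2: "C2 > 0" "\<And>x n. x 0 \<in> gen_dom T \<Longrightarrow> \<forall>n. x (Suc n) = cayley T (\<tau> n) (x n) \<Longrightarrow> n \<ge> 1 \<Longrightarrow>
    norm (x n) \<le> C2 * (1 / sqrt (real n)) * norm (gen T (x 0))"
    by (rule decay_gen_dom[OF c \<tau>]) (rule that; assumption)
  obtain C3 where C3: "C3 > 0" "\<And>y \<delta>. \<delta> > 0 \<Longrightarrow> \<exists>u w. frac_neg_pow T \<alpha> y = u + gen_inv T w \<and>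
    norm u \<le> C3 * \<delta> powr \<alpha> * norm y \<and> norm w \<le> C3 * \<delta> powr (\<alpha> - 1) * norm y"
    by (rule frac_neg_pow_decomposition[OF al]) (rule that; assumption)
  have main: "norm (x n) \<le> (C1 * C3 + C2 * C3) * real n powr (- \<alpha> / 2) * norm (frac_pow T \<alpha> (x 0))"
    if x0: "x 0 \<in> frac_dom T \<alpha>" and x: "\<forall>n. x (Suc n) = cayley T (\<tau> n) (x n)" and n: "n \<ge> 1" for x n
  proof -
    obtain y where y: "x 0 = frac_neg_pow T \<alpha> y" using x0 by (auto simp: frac_dom_def)
    have fy: "frac_pow T \<alpha> (x 0) = y" unfolding y by (rule frac_pow_frac_neg_pow[OF al])
    \<comment> \<open>This balances \<delta>^\<alpha> from u against n^(-1/2) \<delta>^(\<alpha> -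
      1) from w: both equal n^(-\<alpha>/2).\<close>
    define \<delta> where "\<delta> = real n powr (- 1 / 2)"
    have \<delta>: "\<delta> > 0" using n by (simp add: \<delta>_def)
    obtain u w where uw: "x 0 = u + gen_inv T w" "norm u \<le> C3 * \<delta> powr \<alpha> * norm y"
      "norm w \<le> C3 * \<delta> powr (\<alpha> - 1) * norm y"
      using C3(2)[OF \<delta>, of y] y by auto
    define U W where "U = rec_nat u (\<lambda>n. cayley T (\<tau> n))" and "W = rec_nat (gen_inv T w) (\<lambda>n. cayley T (\<tau> n))"
    have U: "\<forall>n. U (Suc n) = cayley T (\<tau> n) (U n)" "U 0 = u" by (simp_all add: U_def)
    have W: "\<forall>n. W (Suc n) = cayley T (\<tau> n) (W n)" "W 0 = gen_inv T w" by (simp_all add: W_def)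
    have "x k = U k + W k" for k
      by (induction k) (simp_all add: uw(1) U W x cayley_add[OF \<tau>_pos])
    then have "norm (x n) \<le> norm (U n) + norm (W n)" by (simp add: norm_triangle_ineq)
    also have "\<dots> \<le> C1 * C3 * real n powr (- \<alpha> / 2) * norm y + C2 * C3 * real n powr (- \<alpha> / 2) * norm y"
    proof (rule add_mono)
      have "norm (U n) \<le> C1 * norm u" using C1(2)[OF U(1)] U(2) by simp
      also have "\<dots> \<le> C1 * (C3 * \<delta> powr \<alpha> * norm y)" using C1(1) uw(2) by (intro mult_left_mono) auto
      also have "\<delta> powr \<alpha> = real n powr (- \<alpha> / 2)" by (simp add: \<delta>_def powr_powr)
      finally show "norm (U n) \<le> C1 * C3 * real n powr (- \<alpha> / 2) * norm y" by (simp only: mult.assoc)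
    next
      have "norm (W n) \<le> C2 * (1 / sqrt (real n)) * norm w"
        using C2(2)[OF _ W(1) n] by (simp add: W(2) gen_inv_dom gen_gen_inv)
      also have "1 / sqrt (real n) = \<delta>"
        using n by (simp add: \<delta>_def powr_half_sqrt[symmetric] flip: powr_minus_divide)
      also have "C2 * \<delta> * norm w \<le> C2 * \<delta> * (C3 * \<delta> powr (\<alpha> - 1) * norm y)"
        using C2(1) \<delta> uw(3) by (intro mult_left_mono) auto
      also have "\<dots> = C2 * C3 * (\<delta> * \<delta> powr (\<alpha> - 1)) * norm y" by (simp only: mult_ac)
      also have "\<delta> * \<delta> powr (\<alpha> - 1) = \<delta> powr \<alpha>" using \<delta> by (simp add: powr_diff)
      also have "\<delta> powr \<alpha> = real n powr (- \<alpha> / 2)" by (simp add: \<delta>_def powr_powr)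
      finally show "norm (W n) \<le> C2 * C3 * real n powr (- \<alpha> / 2) * norm y" .
    qed
    finally show ?thesis by (simp only: fy distrib_right)
  qed
  show thesis
  proof (rule that)
    show "C1 * C3 + C2 * C3 > 0" using C1(1) C2(1) C3(1) by (simp add: add_pos_pos)
  qed (rule main; assumption)
qed

end

theorem theorem3p3:
  fixes T :: "real \<Rightarrow> 'a::{real_inner, complete_space} \<Rightarrow> 'a"
    and \<tau> :: "nat \<Rightarrow> real"
  assumes sg: "C0_semigroup T"
    and stab: "exp_stable T"
    and inv_gen: "\<exists>S. C0_semigroup S \<and> gen_dom S = UNIV \<and>
                      (\<forall>y. gen S y = gen_inv T y) \<and> bounded_semigroup S"
    and tau_inf: "\<exists>c>0. \<forall>n. c \<le> \<tau> n"
    and tau_bdd: "bdd_above (range \<tau>)"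
  shows "(\<forall>\<alpha>. 0 < \<alpha> \<and> \<alpha> < 1 \<longrightarrow>
            (\<exists>K>0. \<forall>x::nat \<Rightarrow> 'a.
               x 0 \<in> frac_dom T \<alpha> \<and> (\<forall>n. x (Suc n) = cayley T (\<tau> n) (x n)) \<longrightarrow>
               (\<forall>n\<ge>1. norm (x n) \<le> K * real n powr (- \<alpha> / 2) * norm (frac_pow T \<alpha> (x 0)))))
       \<and> (\<exists>K>0. \<forall>x::nat \<Rightarrow> 'a.
               x 0 \<in> gen_dom T \<and> (\<forall>n. x (Suc n) = cayley T (\<tau> n) (x n)) \<longrightarrow>
               (\<forall>n\<ge>2. norm (x n) \<le> K * sqrt (ln (real n) / real n) * norm (gen T (x 0))))"
proof -
  obtain S where S: "C0_semigroup S" "gen_dom S = UNIV" "\<And>y. gen S y = gen_inv T y" "bounded_semigroup S"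
    using inv_gen by blast
  obtain M where M: "\<And>t. t \<ge> 0 \<Longrightarrow> onorm (S t) \<le> M"
    using S(4) unfolding bounded_semigroup_def by blast
  obtain K \<omega> where K: "K > 0" "\<omega> > 0" "\<And>t. t \<ge> 0 \<Longrightarrow> onorm (T t) \<le> K * exp (- \<omega> * t)"
    using stab unfolding exp_stable_def by blast
  obtain c where c: "c > 0" "\<And>n. c \<le> \<tau> n" using tau_inf by blast
  obtain d where d: "\<And>n. \<tau> n \<le> d" using tau_bdd by (auto simp: bdd_above_def)
  interpret T: stable_C0_semigroup T K \<omega>
  proof
    fix t :: real and x assume t: "t \<ge> 0"
    then have "bounded_linear (T t)" using sg by (simp add: C0_semigroup_def)
    then have "norm (T t x) \<le> onorm (T t) * norm x" by (rule onorm)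
    also have "\<dots> \<le> K * exp (- \<omega> * t) * norm x" by (intro mult_right_mono K(3) t) simp
    finally show "norm (T t x) \<le> K * exp (- \<omega> * t) * norm x" .
  qed (use sg K in auto)
  obtain b where b: "b > 0" "\<And>x. norm (gen_inv T x) \<le> b * norm x"
    by (rule T.gen_inv_bounded) (rule that; assumption)
  \<comment> \<open>The maximum supplies the strictly positive bound that
    \<open>crank_nicolson\<close> asks for.\<close>
  interpret S: bounded_C0_semigroup S "max M 1"
  proof
    fix t :: real and x assume t: "t \<ge> 0"
    then have "bounded_linear (S t)" using S(1) by (simp add: C0_semigroup_def)
    then have "norm (S t x) \<le> onorm (S t) * norm x" by (rule onorm)
    also have "\<dots> \<le> max M 1 * norm x" using M[OF t] by (intro mult_right_mono) auto
    finally show "norm (S t x) \<le> max M 1 * norm x" .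
  qed (use S(1) in auto)
  interpret crank_nicolson T S K \<omega> "max M 1" b
    by unfold_locales (use K b S in auto)
  show ?thesis
  proof (intro conjI allI impI)
    fix \<alpha> :: real assume al: "0 < \<alpha> \<and> \<alpha> < 1"
    obtain C where C: "C > 0" "\<And>x n. x 0 \<in> frac_dom T \<alpha> \<Longrightarrow> \<forall>n. x (Suc n) = cayley T (\<tau> n) (x n) \<Longrightarrow> n \<ge> 1 \<Longrightarrow>
      norm (x n) \<le> C * real n powr (- \<alpha> / 2) * norm (frac_pow T \<alpha> (x 0))"
      by (rule decay_frac_dom[OF c d conjunct1[OF al] conjunct2[OF al]]) (rule that; assumption)
    show "\<exists>K>0. \<forall>x::nat \<Rightarrow> 'a.
       x 0 \<in> frac_dom T \<alpha> \<and> (\<forall>n. x (Suc n) = cayley T (\<tau> n) (x n)) \<longrightarrow>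
       (\<forall>n\<ge>1. norm (x n) \<le> K * real n powr (- \<alpha> / 2) * norm (frac_pow T \<alpha> (x 0)))"
      by (intro exI[of _ C] conjI C(1) allI impI, rule C(2)) auto
  next
    obtain C where C: "C > 0" "\<And>x n. x 0 \<in> gen_dom T \<Longrightarrow> \<forall>n. x (Suc n) = cayley T (\<tau> n) (x n) \<Longrightarrow> n \<ge> 1 \<Longrightarrow>
      norm (x n) \<le> C * (1 / sqrt (real n)) * norm (gen T (x 0))"
      by (rule decay_gen_dom[OF c d]) (rule that; assumption)
    \<comment> \<open>The rate n^(-1/2) is sharper than the one claimed; the factor sqrt (ln n / ln
      2) >= 1 for n >= 2 weakens it to the stated form.\<close>
    have log: "C * (1 / sqrt (real n)) \<le> C / sqrt (ln 2) * sqrt (ln (real n) / real n)" if "n \<ge> 2" for n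
    proof -
      have "sqrt (ln 2) \<le> sqrt (ln (real n))" using that by simp
      then have "1 \<le> sqrt (ln (real n)) / sqrt (ln 2)" by simp
      then have "C * (1 / sqrt (real n)) * 1 \<le> C * (1 / sqrt (real n)) * (sqrt (ln (real n)) / sqrt (ln 2))"
        using C(1) by (intro mult_left_mono) auto
      then show ?thesis by (simp add: real_sqrt_divide mult.commute)
    qed
    have "norm (x n) \<le> C / sqrt (ln 2) * sqrt (ln (real n) / real n) * norm (gen T (x 0))"
      if "x 0 \<in> gen_dom T" "\<forall>n. x (Suc n) = cayley T (\<tau> n) (x n)" "n \<ge> 2" for x n
    proof -
      have "norm (x n) \<le> C * (1 / sqrt (real n)) * norm (gen T (x 0))"
        using that by (intro C(2)) auto
      also have "\<dots> \<le> C / sqrt (ln 2) * sqrt (ln (real n) / real n) * norm (gen T (x 0))"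
        using log[OF that(3)] by (intro mult_right_mono) auto
      finally show ?thesis .
    qed
    moreover have "C / sqrt (ln 2) > 0" using C(1) by simp
    ultimately show "\<exists>K>0. \<forall>x::nat \<Rightarrow> 'a.
       x 0 \<in> gen_dom T \<and> (\<forall>n. x (Suc n) = cayley T (\<tau> n) (x n)) \<longrightarrow>
       (\<forall>n\<ge>2. norm (x n) \<le> K * sqrt (ln (real n) / real n) * norm (gen T (x 0)))"
      by blast
  qed
qed

end
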